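(* Let $G$ be a graph and let $G'$ be an induced subgraph of $G$. If $G$ is a complete intersection, then so is $G'$.
   Context: Graphs are finite, simple (no loops, no multiple edges) and undirected. Let $k$ be an arbitrary field. For a graph $G$ with $V(G)=\{v_1,\ldots,v_m\}$ and $E(G)=\{e_1,\ldots,e_n\}$, the toric ideal $P_G$ of $G$ is the kernel of the $k$-algebra homomorphism $k[x_1,\ldots,x_n]\to k[t_1,\ldots,t_m]$ with $x_i\mapsto t_jt_l$ whenever $e_i=\{v_j,v_l\}$. $G$ is a complete intersection if $\mu(P_G)=\mathrm{ht}(P_G)$, where $\mu(P_G)$ is the minimal number of generators of $P_G$ (if $P_G=0$ both numbers are $0$). An induced subgraph $G'$ of $G$ is a graph with $V(G')\subset V(G)$ and $E(G')=\{e\in E(G)\mid e\subset V(G')\}$. *)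

theory Defs
  imports "HOL-Library.Poly_Mapping" "HOL-Library.Extended_Nat" "HOL-Algebra.RingHom"
begin

section \<open>Finite simple graphs\<close>

record 'v graph =
  verts :: "'v set"
  edges :: "'v set set"

definition simple_graph :: "'v graph \<Rightarrow> bool" where
  "simple_graph G \<longleftrightarrow> finite (verts G) \<and> (\<forall>e\<in>edges G. e \<subseteq> verts G \<and> card e = 2)"

definition induced_subgraph :: "'v graph \<Rightarrow> 'v graph \<Rightarrow> bool" where
  "induced_subgraph H G \<longleftrightarrow> verts H \<subseteq> verts G \<and> edges H = {e \<in> edges G. e \<subseteq> verts H}"

section \<open>Multivariate polynomial rings\<close>

text \<open>A monomial is its finitely supported exponent function, and a polynomial is a finitely
  supported function from monomials to coefficients; multiplication of poly-mappings is
  convolution. Since the two graphs have different sets of edges, the polynomial ring in the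
  indeterminates from a set \<open>X\<close> is a ring structure with explicit carrier.\<close>

type_synonym ('x, 'k) mpoly = "('x \<Rightarrow>\<^sub>0 nat) \<Rightarrow>\<^sub>0 'k"

definition mpoly_ring :: "'x set \<Rightarrow> ('x, 'k::field) mpoly ring" where
  "mpoly_ring X = \<lparr>carrier = {p. \<forall>m\<in>Poly_Mapping.keys p. Poly_Mapping.keys m \<subseteq> X},
     monoid.mult = (*), one = 1, zero = 0, add = (+)\<rparr>"

definition mpoly_const :: "'k::field \<Rightarrow> ('x, 'k) mpoly" where
  "mpoly_const c = Poly_Mapping.single 0 c"

definition mpoly_var :: "'x \<Rightarrow> ('x, 'k::field) mpoly" where
  "mpoly_var x = Poly_Mapping.single (Poly_Mapping.single x 1) 1"

text \<open>The \<open>k\<close>-algebra homomorphism between polynomial rings that maps each indeterminate \<open>x\<close> to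
  \<open>f x\<close>.\<close>

definition mpoly_subst :: "('x \<Rightarrow> ('y, 'k::field) mpoly) \<Rightarrow> ('x, 'k) mpoly \<Rightarrow> ('y, 'k) mpoly" where
  "mpoly_subst f p = (\<Sum>m\<in>Poly_Mapping.keys p. mpoly_const (Poly_Mapping.lookup p m) *
     (\<Prod>x\<in>Poly_Mapping.keys m. f x ^ Poly_Mapping.lookup m x))"

section \<open>Height and minimal number of generators\<close>

text \<open>\<open>C 0 \<subset> \<dots> \<subset> C n = P\<close> is a chain of prime ideals of length \<open>n\<close>.\<close>

definition prime_height :: "('a, 'b) ring_scheme \<Rightarrow> 'a set \<Rightarrow> enat" where
  "prime_height R P = (SUP n\<in>{n. \<exists>C :: nat \<Rightarrow> 'a set.
     (\<forall>i\<le>n. primeideal (C i) R) \<and> (\<forall>i<n. C i \<subset> C (Suc i)) \<and> C n = P}. enat n)"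

definition ideal_height :: "('a, 'b) ring_scheme \<Rightarrow> 'a set \<Rightarrow> enat" where
  "ideal_height R I = (INF P\<in>{P. primeideal P R \<and> I \<subseteq> P}. prime_height R P)"

text \<open>The value is \<open>\<infinity>\<close> if there is no finite generating set. The zero ideal has the empty
  generating set, and thus the value 0.\<close>

definition min_num_generators :: "('a, 'b) ring_scheme \<Rightarrow> 'a set \<Rightarrow> enat" where
  "min_num_generators R I =
     (INF S\<in>{S. finite S \<and> S \<subseteq> carrier R \<and> Idl\<^bsub>R\<^esub> S = I}. enat (card S))"

section \<open>Toric ideals of graphs\<close>

text \<open>The indeterminates are indexed by the edges and the vertices themselves, so that an edge
  \<open>{v, w}\<close> is mapped to the product of the indeterminates of \<open>v\<close> and \<open>w\<close>.\<close>

definition toric_map :: "('v set, 'k::field) mpoly \<Rightarrow> ('v, 'k) mpoly" where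
  "toric_map = mpoly_subst (\<lambda>e. \<Prod>v\<in>e. mpoly_var v)"

definition toric_ideal :: "'v graph \<Rightarrow> ('v set, 'k::field) mpoly set" where
  "toric_ideal G = a_kernel (mpoly_ring (edges G)) (mpoly_ring (verts G)) toric_map"

definition complete_intersection :: "'k::field itself \<Rightarrow> 'v graph \<Rightarrow> bool" where
  "complete_intersection _ G \<longleftrightarrow>
     (let R = mpoly_ring (edges G) :: ('v set, 'k) mpoly ring; P = toric_ideal G
      in min_num_generators R P = ideal_height R P)"

section \<open>Well-definedness\<close>

lemma mpoly_ring_simps [simp]:
  "monoid.mult (mpoly_ring X) = (*)" "one (mpoly_ring X) = 1"
  "zero (mpoly_ring X) = 0" "add (mpoly_ring X) = (+)"
  by (simp_all add: mpoly_ring_def)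

lemma mem_mpoly_ring_iff:
  "p \<in> carrier (mpoly_ring X) \<longleftrightarrow> (\<forall>m\<in>Poly_Mapping.keys p. Poly_Mapping.keys m \<subseteq> X)"
  by (simp add: mpoly_ring_def)

lemma zero_mem_mpoly_ring: "0 \<in> carrier (mpoly_ring X)"
  by (simp add: mem_mpoly_ring_iff)

lemma mpoly_const_mem: "mpoly_const c \<in> carrier (mpoly_ring X)"
  by (simp add: mem_mpoly_ring_iff mpoly_const_def)

lemma mpoly_var_mem_iff: "mpoly_var x \<in> carrier (mpoly_ring X) \<longleftrightarrow> x \<in> X"
  by (simp add: mem_mpoly_ring_iff mpoly_var_def)

lemma one_mem_mpoly_ring: "1 \<in> carrier (mpoly_ring X)"
  using mpoly_const_mem[of 1 X] by (simp add: mpoly_const_def)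

lemma add_mem_mpoly_ring:
  assumes "p \<in> carrier (mpoly_ring X)" "q \<in> carrier (mpoly_ring X)"
  shows "p + q \<in> carrier (mpoly_ring X)"
  using assms Poly_Mapping.keys_add[of p q] unfolding mem_mpoly_ring_iff by blast

lemma uminus_mem_mpoly_ring:
  assumes "p \<in> carrier (mpoly_ring X)"
  shows "- p \<in> carrier (mpoly_ring X)"
  using assms by (simp add: mem_mpoly_ring_iff in_keys_iff)

lemma mult_mem_mpoly_ring:
  assumes "p \<in> carrier (mpoly_ring X)" "q \<in> carrier (mpoly_ring X)"
  shows "p * q \<in> carrier (mpoly_ring X)"
  unfolding mem_mpoly_ring_iff
proof
  fix m assume "m \<in> Poly_Mapping.keys (p * q)"
  then obtain a b where m: "m = a + b"
    and ab: "a \<in> Poly_Mapping.keys p" "b \<in> Poly_Mapping.keys q"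
    using Poly_Mapping.keys_mult[of p q] by blast
  have "Poly_Mapping.keys a \<subseteq> X" "Poly_Mapping.keys b \<subseteq> X"
    using assms ab by (simp_all add: mem_mpoly_ring_iff)
  with m show "Poly_Mapping.keys m \<subseteq> X"
    using Poly_Mapping.keys_add[of a b] by blast
qed

lemma sum_mem_mpoly_ring:
  "(\<And>i. i \<in> A \<Longrightarrow> g i \<in> carrier (mpoly_ring X)) \<Longrightarrow> sum g A \<in> carrier (mpoly_ring X)"
  by (induction A rule: infinite_finite_induct)
    (simp_all add: zero_mem_mpoly_ring add_mem_mpoly_ring)

lemma prod_mem_mpoly_ring:
  "(\<And>i. i \<in> A \<Longrightarrow> g i \<in> carrier (mpoly_ring X)) \<Longrightarrow> prod g A \<in> carrier (mpoly_ring X)"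
  by (induction A rule: infinite_finite_induct)
    (simp_all add: one_mem_mpoly_ring mult_mem_mpoly_ring)

lemma power_mem_mpoly_ring:
  "p \<in> carrier (mpoly_ring X) \<Longrightarrow> p ^ n \<in> carrier (mpoly_ring X)"
  by (induction n) (simp_all add: one_mem_mpoly_ring mult_mem_mpoly_ring)

lemmas mpoly_ring_closed = zero_mem_mpoly_ring one_mem_mpoly_ring add_mem_mpoly_ring
  mult_mem_mpoly_ring uminus_mem_mpoly_ring

lemma cring_mpoly_ring: "cring (mpoly_ring X)"
proof (rule cringI)
  show "abelian_group (mpoly_ring X)"
  proof (rule abelian_groupI)
    fix p assume "p \<in> carrier (mpoly_ring X)"
    then show "\<exists>y\<in>carrier (mpoly_ring X). y \<oplus>\<^bsub>mpoly_ring X\<^esub> p = \<zero>\<^bsub>mpoly_ring X\<^esub>"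
      by (intro bexI[of _ "- p"]) (simp_all add: uminus_mem_mpoly_ring)
  qed (simp_all add: mpoly_ring_closed algebra_simps)
  show "Group.comm_monoid (mpoly_ring X)"
    by (rule comm_monoidI) (simp_all add: mpoly_ring_closed algebra_simps)
qed (simp add: algebra_simps)

lemma mpoly_const_mult: "mpoly_const (c * d) = mpoly_const c * mpoly_const d"
  by (simp add: mpoly_const_def mult_single)

lemma mpoly_subst_const: "mpoly_subst f (mpoly_const c) = mpoly_const c"
  by (auto simp: mpoly_subst_def mpoly_const_def)

lemma mpoly_subst_var: "mpoly_subst f (mpoly_var x) = f x"
  by (simp add: mpoly_subst_def mpoly_const_def mpoly_var_def)

lemma mpoly_subst_superset:
  assumes "finite A" "Poly_Mapping.keys p \<subseteq> A"
  shows "mpoly_subst f p = (\<Sum>m\<in>A. mpoly_const (Poly_Mapping.lookup p m) *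
     (\<Prod>x\<in>Poly_Mapping.keys m. f x ^ Poly_Mapping.lookup m x))"
  unfolding mpoly_subst_def using assms
  by (intro sum.mono_neutral_left) (auto simp: in_keys_iff mpoly_const_def)

lemma mpoly_subst_add: "mpoly_subst f (p + q) = mpoly_subst f p + mpoly_subst f q"
proof -
  define A where "A = Poly_Mapping.keys p \<union> Poly_Mapping.keys q"
  have "finite A" "Poly_Mapping.keys p \<subseteq> A" "Poly_Mapping.keys q \<subseteq> A"
    "Poly_Mapping.keys (p + q) \<subseteq> A"
    using Poly_Mapping.keys_add[of p q] by (auto simp: A_def)
  then show ?thesis
    by (simp add: mpoly_subst_superset[of A] mpoly_const_def lookup_add single_add
        algebra_simps sum.distrib)
qed

lemma mpoly_monomial_subst_add:
  fixes f :: "'x \<Rightarrow> 'a::comm_monoid_mult"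
  shows "(\<Prod>x\<in>Poly_Mapping.keys (a + b). f x ^ Poly_Mapping.lookup (a + b) x) =
    (\<Prod>x\<in>Poly_Mapping.keys a. f x ^ Poly_Mapping.lookup a x) *
    (\<Prod>x\<in>Poly_Mapping.keys b. f x ^ Poly_Mapping.lookup b x)"
proof -
  define A where "A = Poly_Mapping.keys a \<union> Poly_Mapping.keys b"
  have ext: "(\<Prod>x\<in>Poly_Mapping.keys c. f x ^ Poly_Mapping.lookup c x) =
      (\<Prod>x\<in>A. f x ^ Poly_Mapping.lookup c x)" if "Poly_Mapping.keys c \<subseteq> A" for c
    using that by (intro prod.mono_neutral_left) (auto simp: A_def in_keys_iff)
  show ?thesis
    using Poly_Mapping.keys_add[of a b] ext[of a] ext[of b] ext[of "a + b"]
    by (simp add: A_def lookup_add power_add prod.distrib)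
qed

lemma mpoly_subst_single:
  "mpoly_subst f (Poly_Mapping.single m c) =
     mpoly_const c * (\<Prod>x\<in>Poly_Mapping.keys m. f x ^ Poly_Mapping.lookup m x)"
  by (simp add: mpoly_subst_superset[of "{m}"])

lemma mpoly_induct [case_names zero add]:
  fixes p :: "('x, 'k::field) mpoly"
  assumes "P 0" and "\<And>p m c. P p \<Longrightarrow> P (p + Poly_Mapping.single m c)"
  shows "P p"
proof (induction p rule: update_induct)
  case (update p m c)
  have "Poly_Mapping.update m c p = p + Poly_Mapping.single m c"
    using update(1)
    by (intro poly_mapping_eqI) (auto simp: lookup_update lookup_add lookup_single in_keys_iff)
  with update(3) assms(2) show ?case by simp
qed (rule assms(1))

lemma mpoly_subst_mult: "mpoly_subst f (p * q) = mpoly_subst f p * mpoly_subst f q"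
proof (induction p rule: mpoly_induct)
  case (add p a c)
  have "mpoly_subst f (Poly_Mapping.single a c * q) =
      mpoly_subst f (Poly_Mapping.single a c) * mpoly_subst f q"
  proof (induction q rule: mpoly_induct)
    case (add q b d)
    have "mpoly_subst f (Poly_Mapping.single a c * Poly_Mapping.single b d) =
        mpoly_subst f (Poly_Mapping.single a c) * mpoly_subst f (Poly_Mapping.single b d)"
      by (simp add: mult_single mpoly_subst_single mpoly_const_mult mpoly_monomial_subst_add ac_simps)
    with add show ?case by (simp add: mpoly_subst_add distrib_left)
  qed (simp add: mpoly_subst_def)
  with add show ?case by (simp add: mpoly_subst_add distrib_right)
qed (simp add: mpoly_subst_def)

lemma toric_map_const: "toric_map (mpoly_const c) = mpoly_const c"
  by (simp add: toric_map_def mpoly_subst_const)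

lemma toric_map_var:
  assumes "v \<noteq> w"
  shows "toric_map (mpoly_var {v, w}) = mpoly_var v * mpoly_var w"
  using assms by (simp add: toric_map_def mpoly_subst_var)

lemma toric_map_mem:
  assumes "simple_graph G" "p \<in> carrier (mpoly_ring (edges G))"
  shows "toric_map p \<in> carrier (mpoly_ring (verts G))"
  unfolding toric_map_def mpoly_subst_def
  using assms unfolding simple_graph_def mem_mpoly_ring_iff[of p]
  by (intro sum_mem_mpoly_ring mult_mem_mpoly_ring mpoly_const_mem prod_mem_mpoly_ring
      power_mem_mpoly_ring) (auto simp: mpoly_var_mem_iff subset_iff)

lemma toric_map_ring_hom:
  assumes "simple_graph G"
  shows "toric_map \<in> ring_hom (mpoly_ring (edges G)) (mpoly_ring (verts G))"
  using assms mpoly_subst_const[of _ 1]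
  by (intro ring_hom_memI)
    (simp_all add: toric_map_mem, simp_all add: toric_map_def mpoly_subst_mult mpoly_subst_add mpoly_const_def)

end

theory Submission
  imports Defs
begin

text \<open>
Let \<open>P\<close> be the toric ideal of \<open>G\<close> and \<open>r\<close> the rank of the lattice \<open>L\<close> of integer vectors \<open>u\<close> on the
edges for which the incident entries at every vertex sum to 0; \<open>P\<close> is spanned by the binomials
\<open>x^u - x^v\<close> with \<open>u - v \<in> L\<close>. The proof computes both numbers in the definition of a complete
intersection, for the toric ideal of any homogeneous matrix of natural numbers.

The height of \<open>P\<close> is \<open>r\<close> (\<open>ideal_height_matrix_ideal\<close>). Choose a maximal set \<open>S\<close> of linearly
independent columns, so that there are \<open>r\<close> columns outside \<open>S\<close>. Adding the coordinates outside
\<open>S\<close> one by one to the grading gives a chain of \<open>r\<close> strict inclusions of prime ideals below \<open>P\<close>.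
Conversely, polynomials that witness the strictness of a chain of length \<open>n\<close> are algebraically
independent together with the indeterminates in \<open>S\<close>, which forces \<open>n \<le> r\<close> by counting monomials.

The minimal number of generators is a combinatorial quantity
(\<open>min_num_generators_matrix_ideal\<close>). Link two monomials of the same multidegree if they share an
indeterminate. In every fiber, that is, in every set of all monomials of one multidegree, choose
a representative in each component of the resulting graph, and one of these representatives as a
root. The differences of the other representatives and the roots generate \<open>P\<close>, by induction on the
total degree. Their number is minimal, because the coefficient sums over the components vanish
on the product of \<open>P\<close> with the ideal of all polynomials without constant term.

The exponent differences of these binomials generate \<open>L\<close>. Hence their number is at least \<open>r\<close>, and
it equals \<open>r\<close> if and only if the differences are linearly independent: complete intersection
means independence. The weights of the vertices outside \<open>G'\<close> vanish on the monomials in the edges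
of \<open>G'\<close>, and an edge of \<open>G\<close> on which they all vanish is an edge of \<open>G'\<close> because \<open>G'\<close> is induced.
So a fiber that contains a monomial in the edges of \<open>G'\<close> consists of such monomials, and the chosen
binomials for \<open>G'\<close> are just those among the binomials for \<open>G\<close> that only involve edges of \<open>G'\<close>.
Independence is inherited by subfamilies.
\<close>

section \<open>Homogeneous linear systems\<close>

text \<open>Integral domains are the right generality: the coefficients are elements of \<open>k\<close> when
  polynomials are compared, and integers when lattice vectors are compared.\<close>

lemma nontrivial_solution:
  fixes a :: "'i \<Rightarrow> 'j \<Rightarrow> 'a::idom"
  assumes "finite I" "finite J" "card I < card J"
  shows "\<exists>c. (\<exists>j\<in>J. c j \<noteq> 0) \<and> (\<forall>i\<in>I. (\<Sum>j\<in>J. c j * a i j) = 0)"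
  using assms
proof (induction I arbitrary: J a rule: finite_induct)
  case empty
  then obtain j where "j \<in> J" by fastforce
  then show ?case by (intro exI[of _ "\<lambda>_. 1"]) auto
next
  case (insert i I)
  show ?case
  proof (cases "\<forall>j\<in>J. a i j = 0")
    case True
    obtain c where "\<exists>j\<in>J. c j \<noteq> 0" "\<forall>i\<in>I. (\<Sum>j\<in>J. c j * a i j) = 0"
      using insert.IH[of J a] insert.prems insert.hyps by auto
    with True show ?thesis by (intro exI[of _ c]) auto
  next
    case False
    then obtain q where q: "q \<in> J" "a i q \<noteq> 0" by blast
    define J' where "J' = J - {q}"
    have J': "finite J'" "q \<notin> J'" "J = insert q J'" "card I < card J'"
      using q insert.prems insert.hyps by (auto simp: J'_def)
    \<comment> \<open>The pivot unknown \<open>q\<close> is eliminated without division: row \<open>r\<close> is replaced by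
      \<open>a i q\<close> times row \<open>r\<close> minus \<open>a r q\<close> times row \<open>i\<close>.\<close>
    obtain c where c: "\<exists>j\<in>J'. c j \<noteq> 0"
      "\<forall>r\<in>I. (\<Sum>j\<in>J'. c j * (a i q * a r j - a r q * a i j)) = 0"
      using insert.IH[of J' "\<lambda>r j. a i q * a r j - a r q * a i j"] J' by auto
    define d where "d = (\<lambda>j. if j = q then - (\<Sum>j\<in>J'. c j * a i j) else a i q * c j)"
    have split: "(\<Sum>j\<in>J. d j * a r j) =
        a i q * (\<Sum>j\<in>J'. c j * a r j) - a r q * (\<Sum>j\<in>J'. c j * a i j)" for r
    proof -
      have "(\<Sum>j\<in>J'. d j * a r j) = (\<Sum>j\<in>J'. a i q * (c j * a r j))"
        using J'(2) by (intro sum.cong) (auto simp: d_def)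
      then show ?thesis
        using J' by (simp add: d_def sum_distrib_left mult.commute)
    qed
    have "(\<Sum>j\<in>J. d j * a r j) = 0" if "r \<in> I" for r
    proof -
      have "(\<Sum>j\<in>J'. c j * (a i q * a r j - a r q * a i j)) = 0"
        using c(2) that by blast
      then show ?thesis
        unfolding split by (simp add: algebra_simps sum_subtractf sum_distrib_left)
    qed
    moreover have "(\<Sum>j\<in>J. d j * a i j) = 0"
      unfolding split by simp
    moreover have "\<exists>j\<in>J. d j \<noteq> 0"
      using c(1) q(2) J' by (auto simp: d_def)
    ultimately show ?thesis by (intro exI[of _ d]) auto
  qed
qed

section \<open>Ideals of polynomial rings\<close>

lemma ideal_mpoly_ringI:
  assumes "I \<subseteq> carrier (mpoly_ring X)" "0 \<in> I"
    and "\<And>p q. p \<in> I \<Longrightarrow> q \<in> I \<Longrightarrow> p + q \<in> I"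
    and "\<And>p q. p \<in> carrier (mpoly_ring X) \<Longrightarrow> q \<in> I \<Longrightarrow> p * q \<in> I"
  shows "ideal I (mpoly_ring X)"
proof -
  interpret cring "mpoly_ring X" by (rule cring_mpoly_ring)
  have neg: "- p \<in> I" if "p \<in> I" for p
    using assms(4)[of "-1" p] that by (simp add: uminus_mem_mpoly_ring one_mem_mpoly_ring)
  have "a_inv (mpoly_ring X) p = - p" if "p \<in> carrier (mpoly_ring X)" for p
    using that minus_equality[of "- p" p] by (simp add: uminus_mem_mpoly_ring)
  then have inv: "a_inv (mpoly_ring X) p = - p" if "p \<in> I" for p
    using that assms(1) by auto
  have "subgroup I (add_monoid (mpoly_ring X))"
    using assms(1-3) neg by (intro add.subgroupI) (auto simp: inv)
  moreover have "q * p \<in> I" if "p \<in> carrier (mpoly_ring X)" "q \<in> I" for p q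
    using assms(4)[OF that] by (simp add: mult.commute)
  ultimately show ?thesis
    using assms(4) by (intro idealI) (simp_all add: ring_axioms )
qed

lemma ideal_mpoly_ringD:
  assumes "ideal I (mpoly_ring X)"
  shows "I \<subseteq> carrier (mpoly_ring X)" "0 \<in> I"
    and "\<And>p q. p \<in> I \<Longrightarrow> q \<in> I \<Longrightarrow> p + q \<in> I"
    and "\<And>p q. p \<in> carrier (mpoly_ring X) \<Longrightarrow> q \<in> I \<Longrightarrow> p * q \<in> I"
proof -
  interpret ideal I "mpoly_ring X" by fact
  show "I \<subseteq> carrier (mpoly_ring X)" using a_subset .
  show "0 \<in> I" using additive_subgroup.zero_closed[OF is_additive_subgroup] by simp
  show "p + q \<in> I" if "p \<in> I" "q \<in> I" for p q
    using additive_subgroup.a_closed[OF is_additive_subgroup that] by simp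
  show "p * q \<in> I" if "p \<in> carrier (mpoly_ring X)" "q \<in> I" for p q
    using I_l_closed[OF that(2,1)] by simp
qed

lemma ideal_mpoly_ring_sum:
  assumes "ideal I (mpoly_ring X)" "\<And>i. i \<in> A \<Longrightarrow> f i \<in> I"
  shows "sum f A \<in> I"
  using assms(2)
  by (induction A rule: infinite_finite_induct)
    (auto intro: ideal_mpoly_ringD[OF assms(1)])

lemma primeideal_mpoly_ringD:
  assumes "primeideal P (mpoly_ring X)"
  shows "ideal P (mpoly_ring X)" "1 \<notin> P"
    and "\<And>p q. p \<in> carrier (mpoly_ring X) \<Longrightarrow> q \<in> carrier (mpoly_ring X) \<Longrightarrow> p * q \<in> P \<Longrightarrow>
      p \<in> P \<or> q \<in> P"
proof -
  interpret primeideal P "mpoly_ring X" by fact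
  show "ideal P (mpoly_ring X)" by (rule is_ideal)
  show "1 \<notin> P" using one_imp_carrier I_notcarr by auto
  show "p \<in> P \<or> q \<in> P"
    if "p \<in> carrier (mpoly_ring X)" "q \<in> carrier (mpoly_ring X)" "p * q \<in> P" for p q
    using I_prime[of p q] that by simp
qed

text \<open>A \<open>k\<close>-algebra homomorphism into a domain has a prime kernel. A linear order on the target
  indeterminates makes the monomials an ordered monoid, so that the target is a domain.\<close>

lemma primeideal_kernel_mpoly_subst:
  fixes f :: "'x \<Rightarrow> ('y::linorder, 'k::field) mpoly"
  shows "primeideal {p \<in> carrier (mpoly_ring X). mpoly_subst f p = 0} (mpoly_ring X)"
    (is "primeideal ?K _")
proof (rule primeidealI)
  show "ideal ?K (mpoly_ring X)"
    by (intro ideal_mpoly_ringI)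
      (auto simp: mpoly_subst_add mpoly_subst_mult mpoly_ring_closed, simp add: mpoly_subst_def)
  have "mpoly_subst f 1 = 1"
    using mpoly_subst_const[of f 1] by (simp add: mpoly_const_def)
  then have "1 \<notin> ?K" by simp
  then show "carrier (mpoly_ring X) \<noteq> ?K"
    using one_mem_mpoly_ring by blast
qed (auto simp: cring_mpoly_ring mpoly_subst_mult)

section \<open>Toric ideals of nonnegative integer matrices\<close>

abbreviation keys where "keys \<equiv> Poly_Mapping.keys"
abbreviation lookup where "lookup \<equiv> Poly_Mapping.lookup"
abbreviation monom where "monom \<equiv> Poly_Mapping.single"

definition coeff_sum :: "'m set \<Rightarrow> ('m \<Rightarrow>\<^sub>0 'k::comm_monoid_add) \<Rightarrow> 'k" where
  "coeff_sum A p = (\<Sum>m\<in>keys p \<inter> A. lookup p m)"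

lemma coeff_sum_superset:
  assumes "finite B" "keys p \<subseteq> B"
  shows "coeff_sum A p = (\<Sum>m\<in>B. if m \<in> A then lookup p m else 0)"
proof -
  have "coeff_sum A p = (\<Sum>m\<in>B \<inter> A. lookup p m)"
    unfolding coeff_sum_def using assms
    by (intro sum.mono_neutral_left) (auto simp: in_keys_iff)
  then show ?thesis using assms(1) by (simp add: sum.inter_restrict)
qed

lemma coeff_sum_0 [simp]: "coeff_sum A 0 = 0"
  by (simp add: coeff_sum_def)

lemma coeff_sum_single [simp]: "coeff_sum A (monom m c) = (if m \<in> A then c else 0)"
  by (simp add: coeff_sum_superset[of "{m}"])

lemma coeff_sum_add: "coeff_sum A (p + q) = coeff_sum A p + coeff_sum A q"
proof -
  have "keys (p + q) \<subseteq> keys p \<union> keys q" by (rule Poly_Mapping.keys_add)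
  then show ?thesis
    by (auto simp: coeff_sum_superset[of "keys p \<union> keys q"] lookup_add simp flip: sum.distrib
        intro!: sum.cong)
qed

lemma coeff_sum_diff:
  fixes p q :: "'m \<Rightarrow>\<^sub>0 'k::ab_group_add"
  shows "coeff_sum A (p - q) = coeff_sum A p - coeff_sum A q"
  using coeff_sum_add[of A "p - q" q] by simp

lemma coeff_sum_sum: "coeff_sum A (sum f I) = (\<Sum>i\<in>I. coeff_sum A (f i))"
  by (induction I rule: infinite_finite_induct) (simp_all add: coeff_sum_add)

lemma coeff_sum_monom_mult:
  fixes p :: "('x, 'k::field) mpoly"
  shows "coeff_sum A (monom m c * p) = c * coeff_sum {m'. m + m' \<in> A} p"
proof (induction p rule: mpoly_induct)
  case (add p m' d)
  then show ?case by (simp add: coeff_sum_add distrib_left mult_single)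
qed simp

lemma mpoly_eq_sum_monom: "p = (\<Sum>m\<in>keys p. monom m (lookup p m))"
  by (rule poly_mapping_eqI) (simp add: lookup_sum lookup_single when_def in_keys_iff sum.delta)

definition weight :: "('x \<Rightarrow> nat) \<Rightarrow> ('x \<Rightarrow>\<^sub>0 nat) \<Rightarrow> nat" where
  "weight \<phi> m = (\<Sum>x\<in>keys m. \<phi> x * lookup m x)"

lemma weight_superset:
  "finite B \<Longrightarrow> keys m \<subseteq> B \<Longrightarrow> weight \<phi> m = (\<Sum>x\<in>B. \<phi> x * lookup m x)"
  unfolding weight_def by (intro sum.mono_neutral_left) (auto simp: in_keys_iff)

lemma weight_add: "weight \<phi> (m + m') = weight \<phi> m + weight \<phi> m'"
proof -
  have "keys (m + m') \<subseteq> keys m \<union> keys m'" by (rule Poly_Mapping.keys_add)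
  then show ?thesis
    by (simp add: weight_superset[of "keys m \<union> keys m'"] lookup_add algebra_simps
        flip: sum.distrib)
qed

lemma weight_coordinate: "weight (\<lambda>y. of_bool (y = x)) m = lookup m x"
proof -
  have "weight (\<lambda>y. of_bool (y = x)) m =
      (\<Sum>y\<in>insert x (keys m). of_bool (y = x) * lookup m y)"
    by (rule weight_superset) auto
  also have "\<dots> = (\<Sum>y\<in>insert x (keys m). if y = x then lookup m y else 0)"
    by (intro sum.cong) auto
  finally show ?thesis by (simp add: sum.delta)
qed

definition same_weights ::
    "('x \<Rightarrow> nat) set \<Rightarrow> ('x \<Rightarrow>\<^sub>0 nat) \<Rightarrow> ('x \<Rightarrow>\<^sub>0 nat) \<Rightarrow> bool" where
  "same_weights \<Phi> m m' \<longleftrightarrow> (\<forall>\<phi>\<in>\<Phi>. weight \<phi> m = weight \<phi> m')"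

lemma same_weights_refl [simp]: "same_weights \<Phi> m m"
  by (simp add: same_weights_def)

lemma same_weights_sym: "same_weights \<Phi> m m' \<Longrightarrow> same_weights \<Phi> m' m"
  by (simp add: same_weights_def)

lemma same_weights_trans:
  "same_weights \<Phi> m m' \<Longrightarrow> same_weights \<Phi> m' m'' \<Longrightarrow> same_weights \<Phi> m m''"
  by (simp add: same_weights_def)

lemma same_weights_add_cancel [simp]:
  "same_weights \<Phi> (l + m) (l + m') \<longleftrightarrow> same_weights \<Phi> m m'"
  by (simp add: same_weights_def weight_add)

text \<open>This is the toric ideal of the matrix with the rows \<open>\<Phi>\<close> and the columns \<open>X\<close>: the polynomials
  whose coefficients sum to zero over each set of monomials with equal weights. It is the kernel of
  every monomial map that has the same fibers (\<open>kernel_monomial_map\<close>), so that the target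
  ring can be chosen to suit the purpose.\<close>

definition matrix_ideal :: "'x set \<Rightarrow> ('x \<Rightarrow> nat) set \<Rightarrow> ('x, 'k::field) mpoly set" where
  "matrix_ideal X \<Phi> =
     {p \<in> carrier (mpoly_ring X). \<forall>m. coeff_sum {m'. same_weights \<Phi> m m'} p = 0}"

lemma monom_mem_mpoly_ring: "keys m \<subseteq> X \<Longrightarrow> monom m c \<in> carrier (mpoly_ring X)"
  by (simp add: mem_mpoly_ring_iff)

lemma diff_mem_mpoly_ring:
  "p \<in> carrier (mpoly_ring X) \<Longrightarrow> q \<in> carrier (mpoly_ring X) \<Longrightarrow> p - q \<in> carrier (mpoly_ring X)"
  using add_mem_mpoly_ring[of p X "- q"] by (simp add: uminus_mem_mpoly_ring)

lemma binomial_mem_matrix_ideal: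
  assumes "keys u \<subseteq> X" "keys v \<subseteq> X" "same_weights \<Phi> u v"
  shows "monom u c - monom v c \<in> matrix_ideal X \<Phi>"
proof -
  have "same_weights \<Phi> m u \<longleftrightarrow> same_weights \<Phi> m v" for m
    using assms(3) by (simp add: same_weights_def)
  then show ?thesis
    using assms(1,2)
    by (simp add: matrix_ideal_def coeff_sum_diff diff_mem_mpoly_ring monom_mem_mpoly_ring)
qed

text \<open>Binomials span the ideal: choose one monomial in each class of equal weights and replace
  all monomials by the chosen ones; what remains of \<open>p\<close> is zero, because the coefficients in
  each class cancel.\<close>

lemma matrix_ideal_induct [consumes 1, case_names zero add binomial]:
  assumes p: "p \<in> matrix_ideal X \<Phi>" and zero: "Q 0"
    and add: "\<And>p q. Q p \<Longrightarrow> Q q \<Longrightarrow> Q (p + q)"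
    and binomial: "\<And>u v c. keys u \<subseteq> X \<Longrightarrow> keys v \<subseteq> X \<Longrightarrow> same_weights \<Phi> u v \<Longrightarrow>
      Q (monom u c - monom v c)"
  shows "Q p"
proof -
  define \<sigma> where "\<sigma> m = (SOME m'. same_weights \<Phi> m m' \<and> keys m' \<subseteq> X)" for m
  have \<sigma>: "same_weights \<Phi> m (\<sigma> m)" "keys (\<sigma> m) \<subseteq> X" if "keys m \<subseteq> X" for m
    using someI[of "\<lambda>m'. same_weights \<Phi> m m' \<and> keys m' \<subseteq> X" m] that by (auto simp: \<sigma>_def)
  have keys: "keys m \<subseteq> X" if "m \<in> keys p" for m
    using p that by (auto simp: matrix_ideal_def mem_mpoly_ring_iff)
  have \<sigma>_eq: "\<sigma> m = \<sigma> m'" if "same_weights \<Phi> m m'" for m m'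
  proof -
    have "same_weights \<Phi> m = same_weights \<Phi> m'"
      using that same_weights_trans same_weights_sym by blast
    then show ?thesis by (simp add: \<sigma>_def)
  qed
  have "(\<Sum>m\<in>keys p. monom (\<sigma> m) (lookup p m)) =
      (\<Sum>s\<in>\<sigma> ` keys p. \<Sum>m\<in>{m \<in> keys p. \<sigma> m = s}. monom (\<sigma> m) (lookup p m))"
    by (rule sum.image_gen) simp
  also have "\<dots> = 0"
  proof (rule sum.neutral, rule ballI)
    fix s assume "s \<in> \<sigma> ` keys p"
    then obtain m0 where m0: "m0 \<in> keys p" "s = \<sigma> m0" by blast
    have cls: "{m \<in> keys p. \<sigma> m = s} = keys p \<inter> {m. same_weights \<Phi> m0 m}"
    proof -
      have "\<sigma> m = \<sigma> m0 \<longleftrightarrow> same_weights \<Phi> m0 m" if "m \<in> keys p" for m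
        using \<sigma>_eq[of m0 m] \<sigma>(1)[of m] \<sigma>(1)[of m0] keys that m0(1)
        by (auto simp: same_weights_def)
      then show ?thesis by (auto simp: m0(2))
    qed
    have "(\<Sum>m\<in>{m \<in> keys p. \<sigma> m = s}. monom (\<sigma> m) (lookup p m)) =
        (\<Sum>m\<in>{m \<in> keys p. \<sigma> m = s}. monom s (lookup p m))"
      by (rule sum.cong) auto
    also have "\<dots> = monom s (\<Sum>m\<in>{m \<in> keys p. \<sigma> m = s}. lookup p m)"
      by (induction rule: infinite_finite_induct) (simp_all add: single_add)
    also have "(\<Sum>m\<in>{m \<in> keys p. \<sigma> m = s}. lookup p m) = 0"
      using p unfolding cls matrix_ideal_def coeff_sum_def by blast
    finally show "(\<Sum>m\<in>{m \<in> keys p. \<sigma> m = s}. monom (\<sigma> m) (lookup p m)) = 0" by simp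
  qed
  finally have sum_eq: "(\<Sum>m\<in>keys p. monom m (lookup p m) - monom (\<sigma> m) (lookup p m)) = p"
    by (simp only: sum_subtractf diff_0_right flip: mpoly_eq_sum_monom)
  have "Q (\<Sum>m\<in>A. monom m (lookup p m) - monom (\<sigma> m) (lookup p m))"
    if "A \<subseteq> keys p" for A
    using finite_subset[OF that finite_keys] that
  proof (induction A rule: finite_induct)
    case (insert m A)
    have "Q (monom m (lookup p m) - monom (\<sigma> m) (lookup p m))"
      using keys[of m] insert.prems by (intro binomial \<sigma>) simp_all
    with insert show ?case by (simp add: add)
  qed (simp add: zero)
  from this[OF order_refl] show ?thesis by (simp only: sum_eq)
qed

subsection \<open>Kernels of monomial maps\<close>

text \<open>The monomial map that sends the indeterminate \<open>x\<close> to the monomial \<open>a x\<close> sends the monomial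
  \<open>m\<close> to the monomial with this exponent.\<close>

definition image_exponent :: "('x \<Rightarrow> ('y \<Rightarrow>\<^sub>0 nat)) \<Rightarrow> ('x \<Rightarrow>\<^sub>0 nat) \<Rightarrow> ('y \<Rightarrow>\<^sub>0 nat)" where
  "image_exponent a m = (\<Sum>x\<in>keys m. \<Sum>i<lookup m x. a x)"

lemma lookup_image_exponent: "lookup (image_exponent a m) y = weight (\<lambda>x. lookup (a x) y) m"
  by (simp add: image_exponent_def weight_def lookup_sum mult.commute)

lemma monom_power: "monom d (1::'k::field) ^ n = monom (\<Sum>i<n. d) 1"
  by (induction n) (simp_all add: mult_single add.commute)

lemma prod_monom: "(\<Prod>x\<in>A. monom (d x) (1::'k::field)) = monom (sum d A) 1"
  by (induction A rule: infinite_finite_induct) (simp_all add: mult_single)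

lemma lookup_monomial_map:
  "lookup (mpoly_subst (\<lambda>x. monom (a x) 1) p) d = coeff_sum {m. image_exponent a m = d} p"
proof (induction p rule: mpoly_induct)
  case (add p m c)
  have "mpoly_subst (\<lambda>x. monom (a x) 1) (monom m c) = monom (image_exponent a m) c"
    by (simp add: mpoly_subst_single monom_power prod_monom mpoly_const_def mult_single
        image_exponent_def)
  with add show ?case
    by (simp add: mpoly_subst_add lookup_add coeff_sum_add lookup_single when_def)
qed (simp add: mpoly_subst_def)

lemma kernel_monomial_map:
  assumes "\<And>m m'. keys m \<subseteq> X \<Longrightarrow> keys m' \<subseteq> X \<Longrightarrow>
      image_exponent a m = image_exponent a m' \<longleftrightarrow> same_weights \<Phi> m m'"
  shows "{p \<in> carrier (mpoly_ring X). mpoly_subst (\<lambda>x. monom (a x) 1) p = 0} =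
    (matrix_ideal X \<Phi> :: ('x, 'k::field) mpoly set)"
proof -
  have "mpoly_subst (\<lambda>x. monom (a x) 1) p = 0 \<longleftrightarrow>
      (\<forall>m. coeff_sum {m'. same_weights \<Phi> m m'} p = 0)"
    if p: "p \<in> carrier (mpoly_ring X)" for p :: "('x, 'k) mpoly"
  proof -
    have iff: "(mpoly_subst (\<lambda>x. monom (a x) 1) p = 0) \<longleftrightarrow>
        (\<forall>d. coeff_sum {m. image_exponent a m = d} p = 0)"
      by (simp add: poly_mapping_eq_iff fun_eq_iff lookup_monomial_map)
    have eq: "coeff_sum {m. image_exponent a m = d} p =
        coeff_sum {m'. same_weights \<Phi> m m'} p"
      if "m \<in> keys p" "image_exponent a m = d" for m d
    proof -
      have "keys p \<inter> {m. image_exponent a m = d} = keys p \<inter> {m'. same_weights \<Phi> m m'}"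
        using that p assms[of m] by (auto simp: mem_mpoly_ring_iff) metis+
      then show ?thesis by (simp add: coeff_sum_def)
    qed
    have cls: "coeff_sum {m'. same_weights \<Phi> m m'} p =
        coeff_sum {m'. same_weights \<Phi> m0 m'} p" if "same_weights \<Phi> m m0" for m m0
    proof -
      have "same_weights \<Phi> m = same_weights \<Phi> m0"
        using that same_weights_trans same_weights_sym by blast
      then show ?thesis by simp
    qed
    have empty: "coeff_sum A p = 0" if "\<And>m. m \<in> keys p \<Longrightarrow> m \<notin> A" for A
    proof -
      have "keys p \<inter> A = {}" using that by blast
      then show ?thesis by (simp add: coeff_sum_def)
    qed
    show ?thesis
      unfolding iff
    proof (intro iffI allI)
      fix m assume *: "\<forall>d. coeff_sum {m. image_exponent a m = d} p = 0"
      show "coeff_sum {m'. same_weights \<Phi> m m'} p = 0"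
      proof (cases "\<exists>m0\<in>keys p. same_weights \<Phi> m m0")
        case True
        then obtain m0 where m0: "m0 \<in> keys p" "same_weights \<Phi> m m0" by blast
        show ?thesis using cls[OF m0(2)] eq[OF m0(1) refl] * by simp
      qed (auto intro: empty)
    next
      fix d assume *: "\<forall>m. coeff_sum {m'. same_weights \<Phi> m m'} p = 0"
      show "coeff_sum {m. image_exponent a m = d} p = 0"
      proof (cases "\<exists>m0\<in>keys p. image_exponent a m0 = d")
        case True
        then obtain m0 where m0: "m0 \<in> keys p" "image_exponent a m0 = d" by blast
        show ?thesis using eq[OF m0] * by simp
      qed (auto intro: empty)
    qed
  qed
  then show ?thesis by (auto simp: matrix_ideal_def)
qed

text \<open>A finite list of rows gives a monomial map into a polynomial ring whose indeterminates
  are the positions in the list. Natural numbers are linearly ordered, whatever the type of the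
  columns is, so the target is a domain.\<close>

lemma primeideal_matrix_ideal:
  assumes "finite \<Phi>"
  shows "primeideal (matrix_ideal X \<Phi> :: ('x, 'k::field) mpoly set) (mpoly_ring X)"
proof -
  obtain \<phi>s where \<phi>s: "set \<phi>s = \<Phi>" using assms finite_list by blast
  define a where "a x = (\<Sum>i<length \<phi>s. monom i ((\<phi>s ! i) x))" for x
  have "lookup (a x) i = (if i < length \<phi>s then (\<phi>s ! i) x else 0)" for x i
    by (simp add: a_def lookup_sum lookup_single when_def)
  then have "lookup (image_exponent a m) i =
      (if i < length \<phi>s then weight (\<phi>s ! i) m else 0)" for m i
    by (simp add: lookup_image_exponent weight_def)
  then have "image_exponent a m = image_exponent a m' \<longleftrightarrow> same_weights \<Phi> m m'" for m m'
    by (auto simp: poly_mapping_eq_iff fun_eq_iff same_weights_def all_set_conv_all_nth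
        simp flip: \<phi>s)
  then have "{p \<in> carrier (mpoly_ring X). mpoly_subst (\<lambda>x. monom (a x) 1) p = 0} =
      (matrix_ideal X \<Phi> :: ('x, 'k) mpoly set)"
    by (rule kernel_monomial_map)
  then show ?thesis
    using primeideal_kernel_mpoly_subst[of X "\<lambda>x. monom (a x) (1::'k)"] by simp
qed

section \<open>Kernel vectors and column bases\<close>

definition kernel_vector :: "'x set \<Rightarrow> ('x \<Rightarrow> nat) set \<Rightarrow> ('x \<Rightarrow> int) \<Rightarrow> bool" where
  "kernel_vector X \<Phi> u \<longleftrightarrow> (\<forall>\<phi>\<in>\<Phi>. (\<Sum>x\<in>X. int (\<phi> x) * u x) = 0)"

lemma kernel_vector_sum:
  assumes "\<And>i. i \<in> I \<Longrightarrow> kernel_vector X \<Phi> (u i)"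
  shows "kernel_vector X \<Phi> (\<lambda>x. \<Sum>i\<in>I. c i * u i x)"
  unfolding kernel_vector_def
proof
  fix \<phi> assume "\<phi> \<in> \<Phi>"
  have "(\<Sum>x\<in>X. int (\<phi> x) * (\<Sum>i\<in>I. c i * u i x)) =
      (\<Sum>i\<in>I. c i * (\<Sum>x\<in>X. int (\<phi> x) * u i x))"
    unfolding sum_distrib_left by (subst sum.swap) (simp add: mult.left_commute)
  also have "\<dots> = 0"
    using assms \<open>\<phi> \<in> \<Phi>\<close> by (simp add: kernel_vector_def)
  finally show "(\<Sum>x\<in>X. int (\<phi> x) * (\<Sum>i\<in>I. c i * u i x)) = 0" .
qed

definition exponent_diff :: "('x \<Rightarrow>\<^sub>0 nat) \<Rightarrow> ('x \<Rightarrow>\<^sub>0 nat) \<Rightarrow> 'x \<Rightarrow> int" where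
  "exponent_diff m m' x = int (lookup m x) - int (lookup m' x)"

lemma kernel_vector_exponent_diff:
  assumes "finite X" "keys m \<subseteq> X" "keys m' \<subseteq> X"
  shows "kernel_vector X \<Phi> (exponent_diff m m') \<longleftrightarrow> same_weights \<Phi> m m'"
proof -
  have "(\<Sum>x\<in>X. int (\<phi> x) * exponent_diff m m' x) = int (weight \<phi> m) - int (weight \<phi> m')" for \<phi>
    using assms
    by (simp add: weight_superset[of X] exponent_diff_def right_diff_distrib sum_subtractf)
  then show ?thesis
    by (simp add: kernel_vector_def same_weights_def)
qed

text \<open>Every integer vector is the difference of its positive and its negative part.\<close>

lemma exponent_diff_surj:
  assumes "finite X" "\<And>x. x \<notin> X \<Longrightarrow> u x = 0"
  obtains m m' where "keys m \<subseteq> X" "keys m' \<subseteq> X" "exponent_diff m m' = u"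
proof
  let ?f = "\<lambda>s x. if x \<in> X then nat (s * u x) else 0"
  have lookup: "lookup (Abs_poly_mapping (?f s)) = ?f s" for s
    using assms(1) by (intro lookup_Abs_poly_mapping) (auto intro: finite_subset)
  show "keys (Abs_poly_mapping (?f 1)) \<subseteq> X" "keys (Abs_poly_mapping (?f (-1))) \<subseteq> X"
    by (auto simp: in_keys_iff lookup split: if_splits)
  show "exponent_diff (Abs_poly_mapping (?f 1)) (Abs_poly_mapping (?f (-1))) = u"
    using assms(2) by (auto simp: exponent_diff_def lookup)
qed

text \<open>The columns in \<open>S\<close> are a basis of the rational column space. Linear dependence is expressed by
  integer kernel vectors because these are the exponent differences of binomials.\<close>

definition column_basis :: "'x set \<Rightarrow> ('x \<Rightarrow> nat) set \<Rightarrow> 'x set \<Rightarrow> bool" where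
  "column_basis X \<Phi> S \<longleftrightarrow> S \<subseteq> X \<and>
     (\<forall>u. (\<forall>x. x \<notin> S \<longrightarrow> u x = 0) \<longrightarrow> kernel_vector X \<Phi> u \<longrightarrow> (\<forall>x. u x = 0)) \<and>
     (\<forall>e\<in>X - S. \<exists>u. (\<forall>x. x \<notin> insert e S \<longrightarrow> u x = 0) \<and> kernel_vector X \<Phi> u \<and> u e \<noteq> 0)"

lemma column_basisD:
  assumes "column_basis X \<Phi> S"
  shows "S \<subseteq> X"
    and "\<And>u x. (\<And>x. x \<notin> S \<Longrightarrow> u x = 0) \<Longrightarrow> kernel_vector X \<Phi> u \<Longrightarrow> u x = 0"
    and "\<And>e. e \<in> X - S \<Longrightarrow>
      \<exists>u. (\<forall>x. x \<notin> insert e S \<longrightarrow> u x = 0) \<and> kernel_vector X \<Phi> u \<and> u e \<noteq> 0"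
  using assms unfolding column_basis_def by blast+

lemma ex_column_basis:
  assumes "finite X"
  obtains S where "column_basis X \<Phi> S"
proof -
  define indep where "indep S \<longleftrightarrow> S \<subseteq> X \<and>
    (\<forall>u. (\<forall>x. x \<notin> S \<longrightarrow> u x = 0) \<longrightarrow> kernel_vector X \<Phi> u \<longrightarrow> (\<forall>x. u x = (0::int)))" for S
  have "finite (Collect indep)"
    by (rule finite_subset[of _ "Pow X"]) (auto simp: indep_def assms)
  moreover have "indep {}" by (simp add: indep_def)
  ultimately obtain S where S: "indep S" "\<And>T. indep T \<Longrightarrow> S \<subseteq> T \<Longrightarrow> T = S"
    using finite_has_maximal2[of "Collect indep" "{}"] by auto
  have "\<exists>u. (\<forall>x. x \<notin> insert e S \<longrightarrow> u x = 0) \<and> kernel_vector X \<Phi> u \<and> u e \<noteq> 0"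
    if e: "e \<in> X - S" for e
  proof -
    have "\<not> indep (insert e S)" using S(2)[of "insert e S"] e by auto
    then obtain u x where u: "\<forall>x. x \<notin> insert e S \<longrightarrow> u x = 0" "kernel_vector X \<Phi> u" "u x \<noteq> 0"
      using S(1) e unfolding indep_def by blast
    moreover have "u e \<noteq> 0"
      using S(1) u unfolding indep_def by (metis insert_iff)
    ultimately show ?thesis by blast
  qed
  then show ?thesis using S(1) that[of S] by (auto simp: column_basis_def indep_def)
qed

section \<open>Lengths of chains of prime ideals\<close>

lemma enat_le_prime_heightI:
  assumes "\<And>i. i \<le> n \<Longrightarrow> primeideal (C i) R" "\<And>i. i < n \<Longrightarrow> C i \<subset> C (Suc i)" "C n = P"
  shows "enat n \<le> prime_height R P"
  unfolding prime_height_def using assms by (intro SUP_upper) blast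

text \<open>A chain that ends in the smaller prime ideal is extended by the larger one.\<close>

lemma prime_height_mono:
  assumes "primeideal Q R" "P \<subseteq> Q"
  shows "prime_height R P \<le> prime_height R Q"
  unfolding prime_height_def[of R P]
proof (rule SUP_least)
  fix n assume "n \<in> {n. \<exists>C. (\<forall>i\<le>n. primeideal (C i) R) \<and> (\<forall>i<n. C i \<subset> C (Suc i)) \<and> C n = P}"
  then obtain C where C: "\<And>i. i \<le> n \<Longrightarrow> primeideal (C i) R" "\<And>i. i < n \<Longrightarrow> C i \<subset> C (Suc i)"
    "C n = P" by blast
  show "enat n \<le> prime_height R Q"
  proof (cases "P = Q")
    case True
    then show ?thesis using C by (intro enat_le_prime_heightI[of n C]) simp_all
  next
    case False
    have "C n \<subset> Q" using False C(3) assms(2) by blast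
    have "enat (Suc n) \<le> prime_height R Q"
    proof (rule enat_le_prime_heightI)
      let ?D = "\<lambda>i. if i \<le> n then C i else Q"
      show "primeideal (?D i) R" for i using C(1) assms(1) by simp
      show "?D i \<subset> ?D (Suc i)" if "i < Suc n" for i
      proof (cases "i = n")
        case True
        then show ?thesis using \<open>C n \<subset> Q\<close> by simp
      qed (use that C(2)[of i] in simp)
    qed simp
    moreover have "enat n \<le> enat (Suc n)" by simp
    ultimately show ?thesis using order_trans by blast
  qed
qed

lemma ideal_height_prime:
  assumes "primeideal P R"
  shows "ideal_height R P = prime_height R P"
  unfolding ideal_height_def
  using assms by (intro antisym INF_greatest INF_lower) (auto intro: prime_height_mono)

subsection \<open>Powers along a chain\<close>

primrec power_product :: "(nat \<Rightarrow> 'a::comm_semiring_1) \<Rightarrow> nat \<Rightarrow> nat list \<Rightarrow> 'a" where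
  "power_product g i [] = 1"
| "power_product g i (a # as) = g i ^ a * power_product g (Suc i) as"

lemma power_product_mem_mpoly_ring:
  "(\<And>j. i \<le> j \<Longrightarrow> j < i + length as \<Longrightarrow> g j \<in> carrier (mpoly_ring X)) \<Longrightarrow>
    power_product g i as \<in> carrier (mpoly_ring X)"
  by (induction as arbitrary: i)
    (simp_all add: one_mem_mpoly_ring mult_mem_mpoly_ring power_mem_mpoly_ring)

lemma primeideal_power:
  assumes "primeideal P (mpoly_ring X)" "p \<in> carrier (mpoly_ring X)" "p ^ n \<in> P"
  shows "p \<in> P"
  using assms(3)
proof (induction n)
  case (Suc n)
  then show ?case
    using primeideal_mpoly_ringD(3)[OF assms(1,2) power_mem_mpoly_ring[OF assms(2)], of n] by auto
qed (use primeideal_mpoly_ringD(2)[OF assms(1)] in simp)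

text \<open>The polynomials \<open>g i\<close> that witness the strict inclusions of a chain of primes are
  algebraically independent, modulo the smallest prime, over the indeterminates that are
  independent modulo the largest one. In a relation modulo \<open>C i\<close>, the lowest power of \<open>g i\<close> can be
  divided out because \<open>C i\<close> is prime and does not contain \<open>g i\<close>; modulo \<open>C (Suc i)\<close> there remain
  only the terms in which \<open>g i\<close> had its lowest exponent.\<close>

lemma power_products_independent:
  fixes C :: "nat \<Rightarrow> ('x, 'k::field) mpoly set"
  assumes prime: "\<And>i. i \<le> n \<Longrightarrow> primeideal (C i) (mpoly_ring X)"
    and g: "\<And>i. i < n \<Longrightarrow> g i \<in> C (Suc i) - C i" and sub: "\<And>i. i < n \<Longrightarrow> C i \<subseteq> C (Suc i)"
    and S: "S \<subseteq> X"
    and top: "\<And>M (c :: _ \<Rightarrow> 'k). finite M \<Longrightarrow> (\<And>m. m \<in> M \<Longrightarrow> keys m \<subseteq> S) \<Longrightarrow>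
      (\<Sum>m\<in>M. monom m (c m)) \<in> C n \<Longrightarrow> \<forall>m\<in>M. c m = 0"
    and "i \<le> n" and "finite A"
    and "\<And>as m. (as, m) \<in> A \<Longrightarrow> length as = n - i \<and> keys m \<subseteq> S"
    and "(\<Sum>(as, m)\<in>A. monom m (c (as, m)) * power_product g i as) \<in> C i"
  shows "\<forall>z\<in>A. c z = 0"
  using assms(6-)
proof (induction i arbitrary: A c rule: inc_induct)
  case base
  have inj: "inj_on snd A"
  proof (rule inj_onI)
    fix z w assume "z \<in> A" "w \<in> A" "snd z = snd w"
    then show "z = w" using base(2)[of "fst z" "snd z"] base(2)[of "fst w" "snd w"]
      by (cases z; cases w) auto
  qed
  have Nil: "as = []" if "(as, m) \<in> A" for as m
    using base(2)[OF that] by simp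
  have "(\<Sum>m\<in>snd ` A. monom m (c ([], m))) = (\<Sum>z\<in>A. monom (snd z) (c ([], snd z)))"
    using inj by (simp add: sum.reindex)
  also have "\<dots> = (\<Sum>(as, m)\<in>A. monom m (c (as, m)) * power_product g n as)"
    by (rule sum.cong) (use Nil in fastforce)+
  finally have "(\<Sum>m\<in>snd ` A. monom m (c ([], m))) \<in> C n"
    using base(3) by simp
  then have "\<forall>m\<in>snd ` A. c ([], m) = 0"
  proof (intro top)
    show "keys m \<subseteq> S" if "m \<in> snd ` A" for m
    proof -
      from that obtain as where "(as, m) \<in> A" by force
      then show ?thesis using base(2) by blast
    qed
  qed (use base(1) in simp_all)
  then show ?case using Nil by fastforce
next
  case (step i)
  have i: "i < n" "i \<le> n" using step.hyps by auto
  note ideal = primeideal_mpoly_ringD(1)[OF prime[of "Suc i"]]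
  have gcarr: "g j \<in> carrier (mpoly_ring X)" if "j < n" for j
    using g[OF that] ideal_mpoly_ringD(1)[OF primeideal_mpoly_ringD(1)[OF prime[of "Suc j"]]] that
    by auto
  define t where "t = (\<lambda>a0 (as, m). monom m (c (as, m)) *
    (g i ^ (hd as - a0) * power_product g (Suc i) (tl as)))"
  have tcarr: "t a0 z \<in> carrier (mpoly_ring X)" if "z \<in> A" for a0 z
  proof -
    obtain as m where z: "z = (as, m)" by fastforce
    have "length as = n - i" "keys m \<subseteq> X" using step.prems(2)[of as m] that z S by auto
    then show ?thesis using i
      by (auto simp: t_def z intro!: mult_mem_mpoly_ring power_mem_mpoly_ring gcarr
          power_product_mem_mpoly_ring monom_mem_mpoly_ring)
  qed
  show ?case
  proof (rule ccontr)
    assume "\<not> ?case"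
    \<comment> \<open>Only nonzero coefficients count for the lowest exponent \<open>a0\<close> of \<open>g i\<close>.\<close>
    define A1 where "A1 = {z \<in> A. c z \<noteq> 0}"
    have A1: "finite A1" "A1 \<noteq> {}" "A1 \<subseteq> A"
      using \<open>\<not> ?case\<close> step.prems(1) by (auto simp: A1_def)
    define a0 where "a0 = Min ((\<lambda>z. hd (fst z)) ` A1)"
    have a0_le: "a0 \<le> hd (fst z)" if "z \<in> A1" for z
      using A1 that by (auto simp: a0_def)
    have "a0 \<in> (\<lambda>z. hd (fst z)) ` A1"
      unfolding a0_def using A1 by (intro Min_in) auto
    then obtain z0 where z0: "z0 \<in> A1" "hd (fst z0) = a0" by auto
    have len: "length (fst z) = Suc (n - Suc i)" "keys (snd z) \<subseteq> S" if "z \<in> A" for z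
      using step.prems(2)[of "fst z" "snd z"] that i by auto
    have "(\<Sum>(as, m)\<in>A. monom m (c (as, m)) * power_product g i as) =
        (\<Sum>(as, m)\<in>A1. monom m (c (as, m)) * power_product g i as)"
      using step.prems(1) by (intro sum.mono_neutral_right) (auto simp: A1_def)
    also have "\<dots> = (\<Sum>z\<in>A1. g i ^ a0 * t a0 z)"
    proof (rule sum.cong[OF refl])
      fix z assume z: "z \<in> A1"
      obtain as m where zm: "z = (as, m)" by fastforce
      from z have "as \<noteq> []" using len(1)[of z] A1(3) by (auto simp: zm)
      then obtain a as' where as: "as = a # as'" by (cases as) auto
      have "g i ^ a = g i ^ a0 * g i ^ (a - a0)"
        using a0_le[OF z] by (simp add: zm as flip: power_add)
      then show "(case z of (as, m) \<Rightarrow> monom m (c (as, m)) * power_product g i as) =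
          g i ^ a0 * t a0 z"
        by (simp add: zm as t_def ac_simps)
    qed
    finally have "g i ^ a0 * sum (t a0) A1 \<in> C i"
      using step.prems(3) by (simp add: sum_distrib_left)
    moreover have "sum (t a0) A1 \<in> carrier (mpoly_ring X)"
      using tcarr A1(3) by (intro sum_mem_mpoly_ring) auto
    moreover have "g i ^ a0 \<notin> C i"
      using primeideal_power[OF prime[OF i(2)] gcarr[OF i(1)]] g[OF i(1)] by blast
    ultimately have "sum (t a0) A1 \<in> C i"
      using primeideal_mpoly_ringD(3)[OF prime[OF i(2)]] power_mem_mpoly_ring[OF gcarr[OF i(1)]]
      by blast
    then have sumA1: "sum (t a0) A1 \<in> C (Suc i)" using sub[OF i(1)] by blast
    define A0 where "A0 = {z \<in> A1. hd (fst z) = a0}"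
    have "sum (t a0) (A1 - A0) \<in> C (Suc i)"
    proof (rule ideal_mpoly_ring_sum)
      show "ideal (C (Suc i)) (mpoly_ring X)" using ideal i by simp
      fix z assume z: "z \<in> A1 - A0"
      obtain as m where zm: "z = (as, m)" by fastforce
      have "a0 < hd as" using z a0_le[of z] by (auto simp: A0_def zm)
      then obtain d where d: "hd as - a0 = Suc d" by (metis Suc_diff_Suc)
      have "length (tl as) = n - Suc i" "keys m \<subseteq> X"
        using len[of z] z A1(3) S by (auto simp: zm)
      then have "monom m (c (as, m)) * (g i ^ d * power_product g (Suc i) (tl as))
          \<in> carrier (mpoly_ring X)"
        using i by (auto intro!: mult_mem_mpoly_ring power_mem_mpoly_ring gcarr
          power_product_mem_mpoly_ring monom_mem_mpoly_ring)
      then have "monom m (c (as, m)) * (g i ^ d * power_product g (Suc i) (tl as)) * g i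
          \<in> C (Suc i)"
        using ideal i g[OF i(1)] ideal_mpoly_ringD(4)[of "C (Suc i)" X] by auto
      then show "t a0 z \<in> C (Suc i)" by (simp add: t_def zm d ac_simps)
    qed
    then have "- sum (t a0) (A1 - A0) \<in> C (Suc i)"
      using ideal_mpoly_ringD(4)[of "C (Suc i)" X "- 1"] ideal i
      by (auto simp: uminus_mem_mpoly_ring one_mem_mpoly_ring)
    then have "sum (t a0) A1 + - sum (t a0) (A1 - A0) \<in> C (Suc i)"
      using i(1) by (intro ideal_mpoly_ringD(3)[OF ideal] sumA1) simp_all
    moreover have "sum (t a0) A1 = sum (t a0) A0 + sum (t a0) (A1 - A0)"
      using A1(1) sum.subset_diff[of A0 A1 "t a0"] by (simp add: A0_def add.commute)
    ultimately have A0_mem: "sum (t a0) A0 \<in> C (Suc i)" by simp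
    define tail where "tail z = (tl (fst z), snd z)" for z :: "nat list \<times> ('x \<Rightarrow>\<^sub>0 nat)"
    have A0_Cons: "fst z = a0 # tl (fst z)" if "z \<in> A0" for z
      using that len(1)[of z] A1(3) by (cases "fst z") (auto simp: A0_def)
    have "inj_on tail A0"
    proof (rule inj_onI)
      fix z w assume "z \<in> A0" "w \<in> A0" "tail z = tail w"
      then show "z = w"
        using A0_Cons[of z] A0_Cons[of w] by (cases z; cases w) (simp add: tail_def)
    qed
    then have "(\<Sum>(as, m)\<in>tail ` A0. monom m (c (a0 # as, m)) * power_product g (Suc i) as) =
        (\<Sum>z\<in>A0. monom (snd z) (c (a0 # tl (fst z), snd z)) *
          power_product g (Suc i) (tl (fst z)))"
      by (simp add: sum.reindex case_prod_beta) (simp add: tail_def)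
    also have "\<dots> = sum (t a0) A0"
    proof (rule sum.cong[OF refl])
      fix z assume z: "z \<in> A0"
      then show "monom (snd z) (c (a0 # tl (fst z), snd z)) *
          power_product g (Suc i) (tl (fst z)) = t a0 z"
        using A0_Cons[OF z] by (simp add: t_def case_prod_beta) (simp add: A0_def)
    qed
    finally have "(\<Sum>(as, m)\<in>tail ` A0.
        monom m (c (a0 # as, m)) * power_product g (Suc i) as) \<in> C (Suc i)"
      using A0_mem by simp
    moreover have "finite (tail ` A0)" using A1(1) by (simp add: A0_def)
    moreover have "length as = n - Suc i \<and> keys m \<subseteq> S" if "(as, m) \<in> tail ` A0" for as m
      using that len A1(3) by (fastforce simp: A0_def tail_def)
    ultimately have "\<forall>z\<in>tail ` A0. c (a0 # fst z, snd z) = 0"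
      using step.IH[of "tail ` A0" "\<lambda>z. c (a0 # fst z, snd z)"] by (simp add: case_prod_beta)
    moreover have "z0 \<in> A0" using z0 by (simp add: A0_def)
    ultimately have "c (a0 # fst (tail z0), snd (tail z0)) = 0" by blast
    then have "c z0 = 0"
      using A0_Cons[OF \<open>z0 \<in> A0\<close>] by (cases z0) (simp add: tail_def)
    then show False using z0(1) by (simp add: A1_def)
  qed
qed

subsection \<open>The upper bound for the height\<close>

lemma lookup_const_mult: "lookup (monom 0 a * p) m = a * lookup p m"
  for p :: "('x, 'k::field) mpoly"
  by (induction p rule: mpoly_induct)
    (simp_all add: distrib_left lookup_add mult_single lookup_single when_def)

lemma lookup_outside_keys: "keys m \<subseteq> X \<Longrightarrow> x \<notin> X \<Longrightarrow> lookup m x = 0"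
  by (auto simp: in_keys_iff)

definition monomial_box :: "'x set \<Rightarrow> nat \<Rightarrow> ('x \<Rightarrow>\<^sub>0 nat) set" where
  "monomial_box X d = {m. keys m \<subseteq> X \<and> (\<forall>x. lookup m x < d)}"

lemma monomial_box:
  assumes "finite X" "0 < d"
  shows "finite (monomial_box X d)" "card (monomial_box X d) = d ^ card X"
proof -
  have "bij_betw (\<lambda>m. restrict (lookup m) X) (monomial_box X d) (PiE X (\<lambda>_. {..<d}))"
  proof (rule bij_betwI')
    fix m m' :: "'a \<Rightarrow>\<^sub>0 nat"
    assume m: "m \<in> monomial_box X d" and m': "m' \<in> monomial_box X d"
    have "m = m'" if "restrict (lookup m) X = restrict (lookup m') X"
    proof (rule poly_mapping_eqI)
      fix x
      show "lookup m x = lookup m' x"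
      proof (cases "x \<in> X")
        case True
        then show ?thesis using that by (metis restrict_apply')
      next
        case False
        then show ?thesis using m m' by (simp add: monomial_box_def lookup_outside_keys[of _ X])
      qed
    qed
    then show "restrict (lookup m) X = restrict (lookup m') X \<longleftrightarrow> m = m'" by blast
    show "restrict (lookup m) X \<in> PiE X (\<lambda>_. {..<d})"
      using m by (auto simp: monomial_box_def)
  next
    fix f assume f: "f \<in> PiE X (\<lambda>_. {..<d})"
    define m where "m = Abs_poly_mapping (\<lambda>x. if x \<in> X then f x else 0)"
    have m: "lookup m = (\<lambda>x. if x \<in> X then f x else 0)"
      unfolding m_def using assms(1) by (intro lookup_Abs_poly_mapping) (auto intro: finite_subset)
    show "\<exists>m\<in>monomial_box X d. f = restrict (lookup m) X"
    proof (rule bexI[of _ m])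
      show "f = restrict (lookup m) X"
      proof -
        have "restrict (lookup m) X = restrict f X" by (rule restrict_ext) (simp add: m)
        also have "\<dots> = f" using f by (rule PiE_restrict)
        finally show ?thesis by (rule sym)
      qed
      show "m \<in> monomial_box X d"
      proof -
        have "f x < d" if "x \<in> X" for x using PiE_mem[OF f that] by simp
        then show ?thesis
          using assms(2) by (simp add: monomial_box_def m subset_iff in_keys_iff)
      qed
    qed
  qed
  moreover have "finite (PiE X (\<lambda>_. {..<d}))" "card (PiE X (\<lambda>_. {..<d})) = d ^ card X"
    using assms(1) by (auto simp: finite_PiE card_PiE)
  ultimately show "finite (monomial_box X d)" "card (monomial_box X d) = d ^ card X"
    using bij_betw_finite bij_betw_same_card by metis+
qed

definition exponents_le :: "nat \<Rightarrow> ('x, 'k::zero) mpoly \<Rightarrow> bool" where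
  "exponents_le d p \<longleftrightarrow> (\<forall>m\<in>keys p. \<forall>x. lookup m x \<le> d)"

lemma exponents_le_mono: "exponents_le d p \<Longrightarrow> d \<le> e \<Longrightarrow> exponents_le e p"
  unfolding exponents_le_def using order_trans by blast

lemma exponents_le_mult:
  assumes "exponents_le d p" "exponents_le e q"
  shows "exponents_le (d + e) (p * q :: ('x, 'k::field) mpoly)"
  unfolding exponents_le_def
proof (intro ballI allI)
  fix m x assume "m \<in> keys (p * q)"
  then obtain a b where "m = a + b" "a \<in> keys p" "b \<in> keys q"
    using Poly_Mapping.keys_mult[of p q] by blast
  then show "lookup m x \<le> d + e"
    using assms by (auto simp: exponents_le_def lookup_add intro: add_mono)
qed

lemma exponents_le_power:
  "exponents_le d p \<Longrightarrow> exponents_le (n * d) (p ^ n :: ('x, 'k::field) mpoly)"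
  by (induction n) (auto intro: exponents_le_mult, simp add: exponents_le_def)

lemma exponents_le_power_product:
  fixes g :: "nat \<Rightarrow> ('x, 'k::field) mpoly"
  assumes "\<And>j. i \<le> j \<Longrightarrow> j < i + length as \<Longrightarrow> exponents_le e (g j)"
    and "\<And>a. a \<in> set as \<Longrightarrow> a \<le> d"
  shows "exponents_le (length as * (d * e)) (power_product g i as)"
  using assms
proof (induction as arbitrary: i)
  case Nil
  then show ?case by (simp add: exponents_le_def)
next
  case (Cons a as)
  have "exponents_le (a * e) (g i ^ a)"
    using Cons.prems(1)[of i] by (intro exponents_le_power) simp
  then have "exponents_le (d * e) (g i ^ a)"
    using Cons.prems(2)[of a] by (auto elim: exponents_le_mono)
  moreover have "exponents_le (length as * (d * e)) (power_product g (Suc i) as)"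
    using Cons.prems by (intro Cons.IH) auto
  ultimately show ?case by (auto intro: exponents_le_mult)
qed

lemma ex_exponents_le: "\<exists>d. exponents_le d p"
proof -
  have "finite (\<Union>m\<in>keys p. lookup m ` keys m)" by simp
  then obtain d where d: "\<And>n. n \<in> (\<Union>m\<in>keys p. lookup m ` keys m) \<Longrightarrow> n \<le> d"
    using finite_nat_set_iff_bounded_le by meson
  have "lookup m x \<le> d" if "m \<in> keys p" for m x
  proof (cases "x \<in> keys m")
    case True
    then show ?thesis using d that by blast
  qed (simp add: in_keys_iff)
  then show ?thesis unfolding exponents_le_def by blast
qed

text \<open>Independent columns give distinct weights to distinct monomials, so no nonzero polynomial
  in their indeterminates lies in the ideal.\<close>

lemma column_basis_monomials_independent:
  fixes c :: "('x \<Rightarrow>\<^sub>0 nat) \<Rightarrow> 'k::field"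
  assumes "finite X" "column_basis X \<Phi> S" "finite M" "\<And>m. m \<in> M \<Longrightarrow> keys m \<subseteq> S"
    and "(\<Sum>m\<in>M. monom m (c m)) \<in> matrix_ideal X \<Phi>"
  shows "\<forall>m\<in>M. c m = 0"
proof
  fix m assume m: "m \<in> M"
  have eq: "m' = m" if "m' \<in> M" "same_weights \<Phi> m m'" for m'
  proof (rule poly_mapping_eqI)
    fix x
    have "kernel_vector X \<Phi> (exponent_diff m m')"
      using that m assms(1,4) column_basisD(1)[OF assms(2)]
      by (subst kernel_vector_exponent_diff) blast+
    moreover have "exponent_diff m m' x = 0" if "x \<notin> S" for x
      using that assms(4)[OF m] assms(4)[OF \<open>m' \<in> M\<close>]
      by (simp add: exponent_diff_def lookup_outside_keys)
    ultimately have "exponent_diff m m' x = 0"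
      using column_basisD(2)[OF assms(2), of "exponent_diff m m'" x] by blast
    then show "lookup m' x = lookup m x" by (simp add: exponent_diff_def)
  qed
  have "0 = coeff_sum {m'. same_weights \<Phi> m m'} (\<Sum>m\<in>M. monom m (c m))"
    using assms(5) by (simp add: matrix_ideal_def)
  also have "\<dots> = (\<Sum>m'\<in>M. if m' = m then c m' else 0)"
    unfolding coeff_sum_sum using eq by (intro sum.cong) auto
  finally show "c m = 0" using m assms(3) by (simp add: sum.delta)
qed

text \<open>The algebraically independent elements that a chain of length \<open>n\<close> provides are \<open>n\<close>
  polynomials and the indeterminates of a column basis \<open>S\<close>. Their products with exponents
  below \<open>d\<close> are \<open>d ^ (n + card S)\<close> many, and lie in a space of dimension
  \<open>O(d ^ card X)\<close>.\<close>

lemma prime_chain_length: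
  fixes C :: "nat \<Rightarrow> ('x, 'k::field) mpoly set"
  assumes X: "finite X" and S: "column_basis X \<Phi> S"
    and prime: "\<And>i. i \<le> n \<Longrightarrow> primeideal (C i) (mpoly_ring X)"
    and strict: "\<And>i. i < n \<Longrightarrow> C i \<subset> C (Suc i)" and top: "C n = matrix_ideal X \<Phi>"
  shows "n + card S \<le> card X"
proof (rule ccontr)
  assume less: "\<not> n + card S \<le> card X"
  note SX = column_basisD(1)[OF S]
  have "\<exists>g. \<forall>i<n. g i \<in> C (Suc i) - C i"
    using strict by (intro choice_iff[THEN iffD1]) blast
  then obtain g where g: "\<And>i. i < n \<Longrightarrow> g i \<in> C (Suc i) - C i" by blast
  have gcarr: "g i \<in> carrier (mpoly_ring X)" if "i < n" for i
    using g[OF that] ideal_mpoly_ringD(1)[OF primeideal_mpoly_ringD(1)[OF prime[of "Suc i"]]] that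
    by auto
  obtain e where e: "exponents_le e (g i)" if "i < n" for i
  proof -
    have "\<forall>i. \<exists>d. exponents_le d (g i)" using ex_exponents_le by blast
    then have "\<exists>f. \<forall>i. exponents_le (f i) (g i)" by (rule choice)
    then obtain f where f: "\<And>i. exponents_le (f i) (g i)" by blast
    have "exponents_le (sum f {..<n}) (g i)" if "i < n" for i
      using f that by (auto intro!: exponents_le_mono[OF f] member_le_sum)
    then show ?thesis using that by blast
  qed
  \<comment> \<open>A product with exponents at most \<open>d - 1\<close> has exponents at most \<open>(d - 1) * k\<close> in every
    indeterminate, and \<open>d\<close> exceeds \<open>k ^ card X\<close>, so that there are more products than monomials.\<close>
  define k where "k = n * e + 1"
  define d where "d = k ^ card X + 1"
  define A where "A = {as. set as \<subseteq> {..<d} \<and> length as = n} \<times> monomial_box S d"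
  have fin: "finite S" using SX X finite_subset by blast
  have d: "0 < d" by (simp add: d_def)
  have A: "finite A" "card A = d ^ (n + card S)"
    using monomial_box[OF fin d] finite_lists_length_eq[of "{..<d}" n]
    by (auto simp: A_def card_lists_length_eq power_add)
  define h where "h = (\<lambda>(as, m). monom m (1::'k) * power_product g 0 as)"
  have h_keys: "keys (h z) \<subseteq> monomial_box X (k * d)" if "z \<in> A" for z
  proof -
    obtain as m where z: "z = (as, m)" by fastforce
    have as: "set as \<subseteq> {..<d}" "length as = n" and m: "keys m \<subseteq> S" "\<And>x. lookup m x < d"
      using that by (auto simp: A_def z monomial_box_def)
    have "exponents_le (length as * ((d - 1) * e)) (power_product g 0 as)"
      using as e by (intro exponents_le_power_product) (auto simp: less_eq_Suc_le)
    moreover have "exponents_le (d - 1) (monom m (1::'k))"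
      using m(2) less_Suc_eq_le d by (auto simp: exponents_le_def) (metis Suc_pred)
    ultimately have "exponents_le ((d - 1) + length as * ((d - 1) * e)) (h z)"
      unfolding h_def z by (auto intro: exponents_le_mult)
    moreover have "(d - 1) + length as * ((d - 1) * e) < k * d"
    proof -
      have "(d - 1) + length as * ((d - 1) * e) = (d - 1) * k"
        by (simp add: k_def as algebra_simps)
      also have "\<dots> < d * k" using d by (intro mult_strict_right_mono) (auto simp: k_def)
      finally show ?thesis by (simp add: mult.commute)
    qed
    moreover have "h z \<in> carrier (mpoly_ring X)"
      using as(2) m(1) SX unfolding h_def z
      by (auto intro!: mult_mem_mpoly_ring monom_mem_mpoly_ring power_product_mem_mpoly_ring gcarr)
    ultimately show ?thesis
      unfolding monomial_box_def exponents_le_def mem_mpoly_ring_iff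
      using order.strict_trans1 by blast
  qed
  have kd: "0 < k * d" by (simp add: k_def d_def)
  have "card (monomial_box X (k * d)) < card A"
  proof -
    have "(k * d) ^ card X = k ^ card X * d ^ card X" by (rule power_mult_distrib)
    also have "\<dots> < d * d ^ card X"
      using d by (intro mult_strict_right_mono) (auto simp: d_def)
    also have "\<dots> = d ^ Suc (card X)" by simp
    also have "\<dots> \<le> d ^ (n + card S)"
      using less d by (intro power_increasing) auto
    finally show ?thesis by (simp add: A(2) monomial_box(2)[OF X kd])
  qed
  then obtain c where c: "\<exists>z\<in>A. c z \<noteq> 0"
    "\<forall>m\<in>monomial_box X (k * d). (\<Sum>z\<in>A. c z * lookup (h z) m) = 0"
    using nontrivial_solution[OF monomial_box(1)[OF X kd] A(1), of "\<lambda>m z. lookup (h z) m"] by blast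
  have summand: "monom m (c (as, m)) * power_product g 0 as = mpoly_const (c (as, m)) * h (as, m)"
    for as m
    by (simp add: h_def mpoly_const_def mult_single flip: mult.assoc)
  have "(\<Sum>(as, m)\<in>A. monom m (c (as, m)) * power_product g 0 as) =
      (\<Sum>z\<in>A. mpoly_const (c z) * h z)"
    by (intro sum.cong) (auto simp: summand)
  also have "\<dots> = 0"
  proof (rule poly_mapping_eqI)
    fix m
    have const: "lookup (mpoly_const a * p) m = a * lookup p m" for a and p :: "('x, 'k) mpoly"
      by (simp add: mpoly_const_def lookup_const_mult)
    show "lookup (\<Sum>z\<in>A. mpoly_const (c z) * h z) m = lookup 0 m"
    proof (cases "m \<in> monomial_box X (k * d)")
      case True
      then show ?thesis using c(2) by (simp add: lookup_sum const)
    next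
      case False
      then have "lookup (h z) m = 0" if "z \<in> A" for z
        using h_keys[OF that] by (auto simp: in_keys_iff)
      then show ?thesis by (simp add: lookup_sum const)
    qed
  qed
  finally have "(\<Sum>(as, m)\<in>A. monom m (c (as, m)) * power_product g 0 as) \<in> C 0"
    using ideal_mpoly_ringD(2)[OF primeideal_mpoly_ringD(1)[OF prime[of 0]]] by simp
  then have "\<forall>z\<in>A. c z = 0"
  proof (intro power_products_independent[where n = n and i = 0 and C = C and X = X and S = S
        and g = g])
    show "\<forall>m\<in>M. c m = 0" if "finite M" "\<And>m. m \<in> M \<Longrightarrow> keys m \<subseteq> S"
      "(\<Sum>m\<in>M. monom m (c m)) \<in> C n" for M and c :: "('x \<Rightarrow>\<^sub>0 nat) \<Rightarrow> 'k"
      using column_basis_monomials_independent[OF X S that(1,2)] that(3) by (simp add: top)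
    show "C i \<subseteq> C (Suc i)" if "i < n" for i using strict[OF that] by blast
  qed (use prime g SX A(1) in \<open>auto simp: A_def monomial_box_def\<close>)
  with c(1) show False by blast
qed

subsection \<open>The lower bound for the height\<close>

text \<open>Adding a row is passing to a finer grading, which shrinks the ideal.\<close>

lemma matrix_ideal_antimono:
  assumes "\<Psi> \<subseteq> \<Phi>"
  shows "matrix_ideal X \<Phi> \<subseteq> (matrix_ideal X \<Psi> :: ('x, 'k::field) mpoly set)"
proof
  fix p :: "('x, 'k) mpoly" assume "p \<in> matrix_ideal X \<Phi>"
  then show "p \<in> matrix_ideal X \<Psi>"
  proof (induction rule: matrix_ideal_induct)
    case (binomial u v c)
    then show ?case using assms by (intro binomial_mem_matrix_ideal) (auto simp: same_weights_def)
  qed (auto simp: matrix_ideal_def coeff_sum_add mpoly_ring_closed)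
qed

text \<open>Adding the coordinates outside a column basis as rows, one by one, gives a chain of primes
  below the toric ideal. Each step is strict because a relation between one new column \<open>e\<close> and the
  basis gives a binomial that the coordinate row of \<open>e\<close> excludes.\<close>

lemma card_le_prime_height:
  assumes X: "finite X" and \<Phi>: "finite \<Phi>" and S: "column_basis X \<Phi> S"
  shows "enat (card (X - S)) \<le>
    prime_height (mpoly_ring X) (matrix_ideal X \<Phi> :: ('x, 'k::field) mpoly set)"
proof -
  obtain es where es: "set es = X - S" "distinct es"
    using finite_distinct_list[of "X - S"] X by auto
  define rows where "rows i = \<Phi> \<union> (\<lambda>e x. of_bool (x = e)) ` set (drop i es)" for i
  define C where "C i = (matrix_ideal X (rows i) :: ('x, 'k) mpoly set)" for i
  have "enat (length es) \<le> prime_height (mpoly_ring X) (matrix_ideal X \<Phi> :: ('x, 'k) mpoly set)"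
  proof (rule enat_le_prime_heightI)
    show "primeideal (C i) (mpoly_ring X)" for i
      unfolding C_def rows_def using \<Phi> by (intro primeideal_matrix_ideal) auto
    show "C (length es) = matrix_ideal X \<Phi>" by (simp add: C_def rows_def)
    show "C i \<subset> C (Suc i)" if i: "i < length es" for i
    proof
      have "drop i es = es ! i # drop (Suc i) es"
        using i by (simp add: Cons_nth_drop_Suc)
      then have "set (drop i es) = insert (es ! i) (set (drop (Suc i) es))"
        "distinct (es ! i # drop (Suc i) es)"
        using distinct_drop[OF es(2), of i] by (metis list.simps(15))+
      then have sub: "set (drop (Suc i) es) \<subseteq> set (drop i es)" "es ! i \<in> set (drop i es)"
        and notin: "es ! i \<notin> set (drop (Suc i) es)"
        by auto
      show "C i \<subseteq> C (Suc i)"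
        unfolding C_def using sub by (intro matrix_ideal_antimono) (auto simp: rows_def)
      define e where "e = es ! i"
      have e: "e \<in> X - S" using nth_mem[OF i] unfolding es(1) e_def .
      obtain u where u: "\<forall>x. x \<notin> insert e S \<longrightarrow> u x = 0" "kernel_vector X \<Phi> u" "u e \<noteq> 0"
        using column_basisD(3)[OF S e] by blast
      obtain m m' where m: "keys m \<subseteq> X" "keys m' \<subseteq> X" "exponent_diff m m' = u"
      proof (rule exponent_diff_surj[OF X])
        show "u x = 0" if "x \<notin> X" for x
        proof -
          have "x \<notin> insert e S" using e column_basisD(1)[OF S] that by blast
          then show ?thesis using u(1) by simp
        qed
      qed
      have same: "same_weights \<Phi> m m'"
        using kernel_vector_exponent_diff[OF X m(1,2)] u(2) m(3) by simp
      have coord: "lookup m x = lookup m' x \<longleftrightarrow> u x = 0" for x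
        by (simp add: exponent_diff_def flip: m(3))
      have "u x = 0" if "x \<in> set (drop (Suc i) es)" for x
      proof -
        have "x \<in> X - S" using that set_drop_subset[of "Suc i" es] unfolding es(1) by blast
        moreover have "x \<noteq> e" using that notin unfolding e_def by blast
        ultimately show ?thesis using u(1) by blast
      qed
      then have "same_weights (rows (Suc i)) m m'"
        using same by (auto simp: rows_def same_weights_def weight_coordinate coord)
      then have "monom m (1::'k) - monom m' 1 \<in> C (Suc i)"
        unfolding C_def using m by (intro binomial_mem_matrix_ideal)
      moreover have "\<not> same_weights (rows i) m m'"
      proof
        assume "same_weights (rows i) m m'"
        moreover have "(\<lambda>x. of_bool (x = e)) \<in> rows i"
          using sub(2) by (auto simp: rows_def e_def)
        ultimately have "lookup m e = lookup m' e"
          unfolding same_weights_def weight_coordinate[symmetric] by blast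
        then show False using coord u(3) by simp
      qed
      then have "coeff_sum {l. same_weights (rows i) m l} (monom m (1::'k) - monom m' 1) \<noteq> 0"
        by (simp add: coeff_sum_diff)
      then have "monom m (1::'k) - monom m' 1 \<notin> C i"
        unfolding C_def matrix_ideal_def by blast
      ultimately show "C i \<noteq> C (Suc i)" by blast
    qed
  qed
  then show ?thesis using distinct_card[OF es(2)] es(1) by simp
qed

theorem ideal_height_matrix_ideal:
  assumes X: "finite X" and \<Phi>: "finite \<Phi>" and S: "column_basis X \<Phi> S"
  shows "ideal_height (mpoly_ring X) (matrix_ideal X \<Phi> :: ('x, 'k::field) mpoly set) =
    enat (card (X - S))"
proof -
  have "prime_height (mpoly_ring X) (matrix_ideal X \<Phi> :: ('x, 'k) mpoly set) \<le> enat (card (X - S))"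
    unfolding prime_height_def
  proof (rule SUP_least, clarify)
    fix n and C :: "nat \<Rightarrow> ('x, 'k) mpoly set"
    assume "\<forall>i\<le>n. primeideal (C i) (mpoly_ring X)" "\<forall>i<n. C i \<subset> C (Suc i)"
      "C n = matrix_ideal X \<Phi>"
    then have "n + card S \<le> card X" using prime_chain_length[OF X S, of n C] by blast
    then show "enat n \<le> enat (card (X - S))"
      using card_Diff_subset[OF finite_subset[OF column_basisD(1)[OF S] X] column_basisD(1)[OF S]]
      by simp
  qed
  then show ?thesis
    using card_le_prime_height[OF assms]
    unfolding ideal_height_prime[OF primeideal_matrix_ideal[OF \<Phi>]] by (rule order.antisym)
qed

section \<open>Components of the fibers\<close>

definition overlap :: "'x set \<Rightarrow> ('x \<Rightarrow> nat) set \<Rightarrow> ('x \<Rightarrow>\<^sub>0 nat) \<Rightarrow> ('x \<Rightarrow>\<^sub>0 nat) \<Rightarrow> bool" where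
  "overlap X \<Phi> m m' \<longleftrightarrow>
     keys m \<subseteq> X \<and> keys m' \<subseteq> X \<and> same_weights \<Phi> m m' \<and> keys m \<inter> keys m' \<noteq> {}"

abbreviation linked :: "'x set \<Rightarrow> ('x \<Rightarrow> nat) set \<Rightarrow> ('x \<Rightarrow>\<^sub>0 nat) \<Rightarrow> ('x \<Rightarrow>\<^sub>0 nat) \<Rightarrow> bool" where
  "linked X \<Phi> \<equiv> (overlap X \<Phi>)\<^sup>*\<^sup>*"

lemma linked_sym: "linked X \<Phi> m m' \<Longrightarrow> linked X \<Phi> m' m"
  by (rule sympD[OF symp_rtranclp])
    (auto simp: symp_def overlap_def same_weights_def)

lemma linked_same_weights: "linked X \<Phi> m m' \<Longrightarrow> same_weights \<Phi> m m'"
  by (induction rule: rtranclp_induct) (auto simp: overlap_def same_weights_def)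

lemma linked_keys: "linked X \<Phi> m m' \<Longrightarrow> keys m \<subseteq> X \<Longrightarrow> keys m' \<subseteq> X"
  by (induction rule: rtranclp_induct) (auto simp: overlap_def)

lemma linked_eq: "linked X \<Phi> m m' \<Longrightarrow> linked X \<Phi> m = linked X \<Phi> m'"
  by (intro ext iffI) (blast intro: linked_sym rtranclp_trans)+

text \<open>Linked monomials have the same links, so the choice depends only on the component.\<close>

definition component_rep :: "'x set \<Rightarrow> ('x \<Rightarrow> nat) set \<Rightarrow> ('x \<Rightarrow>\<^sub>0 nat) \<Rightarrow> ('x \<Rightarrow>\<^sub>0 nat)" where
  "component_rep X \<Phi> m = (SOME m'. linked X \<Phi> m m')"

text \<open>Monomials with the same weights have the same root, which is the representative of one of the
  components of their fiber.\<close>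

definition fiber_root :: "'x set \<Rightarrow> ('x \<Rightarrow> nat) set \<Rightarrow> ('x \<Rightarrow>\<^sub>0 nat) \<Rightarrow> ('x \<Rightarrow>\<^sub>0 nat)" where
  "fiber_root X \<Phi> m = component_rep X \<Phi> (SOME m'. keys m' \<subseteq> X \<and> same_weights \<Phi> m m')"

definition nonroot_reps :: "'x set \<Rightarrow> ('x \<Rightarrow> nat) set \<Rightarrow> ('x \<Rightarrow>\<^sub>0 nat) set" where
  "nonroot_reps X \<Phi> = {m. keys m \<subseteq> X \<and> component_rep X \<Phi> m = m \<and> fiber_root X \<Phi> m \<noteq> m}"

lemma linked_component_rep: "linked X \<Phi> m (component_rep X \<Phi> m)"
  unfolding component_rep_def by (rule someI[of _ m]) simp

lemma component_rep_cong: "linked X \<Phi> m m' \<Longrightarrow> component_rep X \<Phi> m = component_rep X \<Phi> m'"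
  unfolding component_rep_def by (drule linked_eq) simp

lemma fiber_root_cong:
  assumes "same_weights \<Phi> m m'"
  shows "fiber_root X \<Phi> m = fiber_root X \<Phi> m'"
proof -
  have "same_weights \<Phi> m = same_weights \<Phi> m'"
    using assms by (auto simp: same_weights_def)
  then show ?thesis by (simp add: fiber_root_def)
qed

lemma fiber_root:
  assumes "keys m \<subseteq> X"
  shows "keys (fiber_root X \<Phi> m) \<subseteq> X" "same_weights \<Phi> m (fiber_root X \<Phi> m)"
    and "component_rep X \<Phi> (fiber_root X \<Phi> m) = fiber_root X \<Phi> m"
proof -
  define m0 where "m0 = (SOME m'. keys m' \<subseteq> X \<and> same_weights \<Phi> m m')"
  have m0: "keys m0 \<subseteq> X" "same_weights \<Phi> m m0"
    using someI[of "\<lambda>m'. keys m' \<subseteq> X \<and> same_weights \<Phi> m m'" m] assms by (auto simp: m0_def)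
  have root: "fiber_root X \<Phi> m = component_rep X \<Phi> m0"
    by (simp add: fiber_root_def m0_def)
  have linked: "linked X \<Phi> m0 (component_rep X \<Phi> m0)" by (rule linked_component_rep)
  show "keys (fiber_root X \<Phi> m) \<subseteq> X"
    unfolding root using linked_keys[OF linked m0(1)] .
  show "same_weights \<Phi> m (fiber_root X \<Phi> m)"
    unfolding root using same_weights_trans[OF m0(2) linked_same_weights[OF linked]] .
  show "component_rep X \<Phi> (fiber_root X \<Phi> m) = fiber_root X \<Phi> m"
    unfolding root using component_rep_cong[OF linked] by simp
qed

subsection \<open>Generating the congruence\<close>

text \<open>The ideal is homogeneous for the total degree. In particular a variable that two monomials of
  a fiber share can be cancelled in an induction on the degree.\<close>

definition homogeneous :: "'x set \<Rightarrow> ('x \<Rightarrow> nat) set \<Rightarrow> bool" where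
  "homogeneous X \<Phi> \<longleftrightarrow> (\<forall>m m'. keys m \<subseteq> X \<longrightarrow> keys m' \<subseteq> X \<longrightarrow> same_weights \<Phi> m m' \<longrightarrow>
     weight (\<lambda>_. 1) m = weight (\<lambda>_. 1) m')"

lemma split_off_variable:
  assumes "x \<in> keys (m :: 'x \<Rightarrow>\<^sub>0 nat)"
  obtains m' where "m = monom x 1 + m'" "keys m' \<subseteq> keys m"
proof
  show "m = monom x 1 + (m - monom x 1)"
    using assms by (intro poly_mapping_eqI)
      (auto simp: lookup_add lookup_minus lookup_single when_def in_keys_iff)
  show "keys (m - monom x 1) \<subseteq> keys m"
    by (auto simp: in_keys_iff lookup_minus)
qed

text \<open>The pairs of a nonroot representative and its root generate the congruence of equal weights.
  Monomials that share an indeterminate \<open>x\<close> differ by \<open>x\<close> times a pair of smaller degree, which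
  connects each monomial to the representative of its component, and hence to the root. The rule
  is used twice: for binomials in an ideal, and for exponent differences in a lattice.\<close>

lemma same_weights_induct [consumes 4, case_names refl sym trans shift root]:
  assumes hom: "homogeneous X \<Phi>"
    and "keys u \<subseteq> X" "keys v \<subseteq> X" "same_weights \<Phi> u v"
    and refl: "\<And>u. Q u u" and sym: "\<And>u v. Q u v \<Longrightarrow> Q v u"
    and trans: "\<And>u v w. Q u v \<Longrightarrow> Q v w \<Longrightarrow> Q u w"
    and shift: "\<And>x u v. x \<in> X \<Longrightarrow> Q u v \<Longrightarrow> Q (monom x 1 + u) (monom x 1 + v)"
    and root: "\<And>b. b \<in> nonroot_reps X \<Phi> \<Longrightarrow> Q b (fiber_root X \<Phi> b)"
  shows "Q u v"
  using assms(2-4)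
proof (induction "weight (\<lambda>_. 1) u" arbitrary: u v rule: less_induct)
  case (less u v)
  have overlap: "Q w w'"
    if "overlap X \<Phi> w w'" "weight (\<lambda>_. 1) w = weight (\<lambda>_. 1) u" for w w'
  proof -
    from that(1) obtain x where x: "x \<in> keys w" "x \<in> keys w'" "x \<in> X"
      by (auto simp: overlap_def)
    obtain m where m: "w = monom x 1 + m" "keys m \<subseteq> keys w" by (rule split_off_variable[OF x(1)])
    obtain m' where m': "w' = monom x 1 + m'" "keys m' \<subseteq> keys w'"
      by (rule split_off_variable[OF x(2)])
    have "weight (\<lambda>_. 1) m < weight (\<lambda>_. 1) u"
    proof -
      have "weight (\<lambda>_. 1) (monom x (1::nat)) = 1" by (simp add: weight_def)
      then show ?thesis using that(2) unfolding m(1) weight_add by linarith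
    qed
    moreover have "same_weights \<Phi> m m'" "keys m \<subseteq> X" "keys m' \<subseteq> X"
      using that(1) m m' by (auto simp: overlap_def)
    ultimately have "Q m m'" by (intro less.hyps)
    then show "Q w w'" unfolding m(1) m'(1) by (rule shift[OF x(3)])
  qed
  have linked: "Q w w'" if "linked X \<Phi> w w'" "keys w \<subseteq> X" "same_weights \<Phi> u w" for w w'
    using that(1)
  proof (induction rule: rtranclp_induct)
    case base
    show ?case by (rule refl)
  next
    case (step y z)
    have "same_weights \<Phi> u y" "keys y \<subseteq> X"
      using same_weights_trans[OF that(3) linked_same_weights[OF step.hyps(1)]]
        linked_keys[OF step.hyps(1) that(2)] by auto
    then have "weight (\<lambda>_. 1) y = weight (\<lambda>_. 1) u"
      using hom less.prems(1) unfolding homogeneous_def by metis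
    then show ?case using trans[OF step.IH overlap[OF step.hyps(2)]] by blast
  qed
  have to_root: "Q w (fiber_root X \<Phi> u)" if w: "keys w \<subseteq> X" "same_weights \<Phi> u w" for w
  proof -
    define b where "b = component_rep X \<Phi> w"
    have wb: "linked X \<Phi> w b" unfolding b_def by (rule linked_component_rep)
    have eq: "fiber_root X \<Phi> b = fiber_root X \<Phi> u"
      using fiber_root_cong[of \<Phi> u b] same_weights_trans[OF w(2) linked_same_weights[OF wb]] by simp
    have "component_rep X \<Phi> b = b"
      using component_rep_cong[OF wb] by (simp add: b_def)
    then have "b \<in> nonroot_reps X \<Phi> \<or> fiber_root X \<Phi> b = b"
      using linked_keys[OF wb w(1)] by (auto simp: nonroot_reps_def)
    then have "Q b (fiber_root X \<Phi> b)" using root refl by metis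
    then show ?thesis using trans[OF linked[OF wb w]] by (simp add: eq)
  qed
  show ?case
    using trans[OF to_root sym[OF to_root]] less.prems by simp
qed

section \<open>The minimal number of generators\<close>

lemma matrix_ideal_eq_Idl:
  assumes hom: "homogeneous X \<Phi>" and \<Phi>: "finite \<Phi>"
  shows "Idl\<^bsub>mpoly_ring X\<^esub> ((\<lambda>b. monom b 1 - monom (fiber_root X \<Phi> b) 1) ` nonroot_reps X \<Phi>) =
    (matrix_ideal X \<Phi> :: ('x, 'k::field) mpoly set)" (is "Idl\<^bsub>_\<^esub> ?T = ?P")
proof -
  interpret cring "mpoly_ring X :: ('x, 'k) mpoly ring" by (rule cring_mpoly_ring)
  have P: "ideal ?P (mpoly_ring X)"
    using primeideal_mpoly_ringD(1)[OF primeideal_matrix_ideal[OF \<Phi>]] .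
  have TP: "?T \<subseteq> ?P"
    by (auto simp: nonroot_reps_def intro!: binomial_mem_matrix_ideal fiber_root)
  then have T: "?T \<subseteq> carrier (mpoly_ring X)"
    using ideal_mpoly_ringD(1)[OF P] by blast
  let ?I = "Idl\<^bsub>mpoly_ring X\<^esub> ?T"
  have I: "ideal ?I (mpoly_ring X)" using genideal_ideal[OF T] .
  note I_closed = ideal_mpoly_ringD[OF I]
  have neg: "- p \<in> ?I" if "p \<in> ?I" for p
    using I_closed(4)[of "-1" p] that by (simp add: uminus_mem_mpoly_ring one_mem_mpoly_ring)
  have "p \<in> ?I" if "p \<in> ?P" for p
    using that
  proof (induction rule: matrix_ideal_induct)
    case (binomial u v c)
    have "monom u 1 - monom v 1 \<in> ?I"
      using hom binomial
    proof (induction rule: same_weights_induct)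
      case (refl u)
      then show ?case using I_closed(2) by simp
    next
      case (sym u v)
      then show ?case using neg by force
    next
      case (trans u v w)
      then show ?case using I_closed(3)[OF trans] by simp
    next
      case (shift x u v)
      have "monom (monom x 1) 1 * (monom u 1 - monom v 1) \<in> ?I"
        using shift by (intro I_closed(4)) (auto simp: monom_mem_mpoly_ring)
      then show ?case by (simp add: right_diff_distrib mult_single)
    next
      case (root b)
      then show ?case using genideal_self[OF T] by blast
    qed
    then have "mpoly_const c * (monom u 1 - monom v 1) \<in> ?I"
      by (rule I_closed(4)[OF mpoly_const_mem])
    then show ?case by (simp add: mpoly_const_def right_diff_distrib mult_single)
  qed (auto intro: I_closed)
  then show ?thesis using genideal_minimal[OF P TP] by blast
qed

text \<open>The coefficient sum over a component kills the multiples of \<open>f\<close> by a monomial \<open>m \<noteq> 1\<close>: as the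
  products of \<open>m\<close> with the monomials of a fiber all share an indeterminate, the component
  contains all of them or none, and the coefficients of \<open>f\<close> in a fiber sum to zero.\<close>

lemma component_functional_mult:
  fixes f g :: "('x, 'k::field) mpoly"
  assumes f: "f \<in> matrix_ideal X \<Phi>" and g: "g \<in> carrier (mpoly_ring X)" and b: "keys b \<subseteq> X"
  shows "coeff_sum {m. linked X \<Phi> b m} (g * f) =
    lookup g 0 * coeff_sum {m. linked X \<Phi> b m} f"
proof -
  have keysf: "keys m \<subseteq> X" if "m \<in> keys f" for m
    using f that by (auto simp: matrix_ideal_def mem_mpoly_ring_iff)
  have zero: "coeff_sum {m'. linked X \<Phi> b (m + m')} f = 0"
    if m: "m \<in> keys g" "m \<noteq> 0" for m
  proof (cases "\<exists>m0\<in>keys f. linked X \<Phi> b (m + m0)")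
    case True
    then obtain m0 where m0: "m0 \<in> keys f" "linked X \<Phi> b (m + m0)" by blast
    have keysm: "keys m \<subseteq> X" using g m(1) by (auto simp: mem_mpoly_ring_iff)
    have "linked X \<Phi> b (m + m') \<longleftrightarrow> same_weights \<Phi> m0 m'" if m': "m' \<in> keys f" for m'
    proof
      assume "linked X \<Phi> b (m + m')"
      then have "linked X \<Phi> (m + m0) (m + m')"
        using rtranclp_trans[OF linked_sym[OF m0(2)]] by blast
      then show "same_weights \<Phi> m0 m'" using linked_same_weights by fastforce
    next
      assume same: "same_weights \<Phi> m0 m'"
      obtain x where "x \<in> keys m" using m(2) by (metis ex_in_conv keys_eq_empty)
      then have "x \<in> keys (m + m0)" "x \<in> keys (m + m')"
        by (auto simp: in_keys_iff lookup_add)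
      moreover have "keys (m + m0) \<subseteq> X" "keys (m + m') \<subseteq> X"
        using Poly_Mapping.keys_add[of m] keysm keysf m0(1) m' by blast+
      ultimately have "overlap X \<Phi> (m + m0) (m + m')"
        using same by (auto simp: overlap_def)
      then show "linked X \<Phi> b (m + m')" using m0(2) by simp
    qed
    then have "keys f \<inter> {m'. linked X \<Phi> b (m + m')} = keys f \<inter> {m'. same_weights \<Phi> m0 m'}"
      by blast
    moreover have "coeff_sum {m'. same_weights \<Phi> m0 m'} f = 0"
      using f by (simp add: matrix_ideal_def)
    ultimately show ?thesis by (simp add: coeff_sum_def)
  next
    case False
    then have "keys f \<inter> {m'. linked X \<Phi> b (m + m')} = {}" by blast
    then show ?thesis by (simp add: coeff_sum_def)
  qed
  have "g * f = (\<Sum>m\<in>keys g. monom m (lookup g m) * f)"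
    by (simp flip: sum_distrib_right mpoly_eq_sum_monom)
  then have "coeff_sum {m. linked X \<Phi> b m} (g * f) =
      (\<Sum>m\<in>keys g. lookup g m * coeff_sum {m'. linked X \<Phi> b (m + m')} f)"
    by (simp add: coeff_sum_sum coeff_sum_monom_mult)
  also have "\<dots> = (\<Sum>m\<in>keys g. if m = 0 then lookup g 0 * coeff_sum {m. linked X \<Phi> b m} f else 0)"
    by (intro sum.cong) (auto simp: zero)
  also have "\<dots> = lookup g 0 * coeff_sum {m. linked X \<Phi> b m} f"
    by (simp add: sum.delta in_keys_iff)
  finally show ?thesis .
qed

text \<open>On the ideal, the functionals of the components without root have, as a vector, a value in the
  span of their values at the generators. On the binomials of the nonroot representatives these
  vectors are the unit vectors, so there are at least as many generators.\<close>

lemma card_nonroot_reps_le_generators: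
  fixes T :: "('x, 'k::field) mpoly set"
  assumes \<Phi>: "finite \<Phi>" and fin: "finite T" and T: "T \<subseteq> carrier (mpoly_ring X)"
    and gen: "Idl\<^bsub>mpoly_ring X\<^esub> T = matrix_ideal X \<Phi>"
  shows "finite (nonroot_reps X \<Phi>)" "card (nonroot_reps X \<Phi>) \<le> card T"
proof -
  interpret cring "mpoly_ring X :: ('x, 'k) mpoly ring" by (rule cring_mpoly_ring)
  let ?P = "matrix_ideal X \<Phi> :: ('x, 'k) mpoly set"
  let ?B = "nonroot_reps X \<Phi>"
  define L where "L b p = coeff_sum {m. linked X \<Phi> b m} p" for b and p :: "('x, 'k) mpoly"
  have P: "ideal ?P (mpoly_ring X)"
    using primeideal_mpoly_ringD(1)[OF primeideal_matrix_ideal[OF \<Phi>]] .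
  note P_closed = ideal_mpoly_ringD[OF P]
  define N where "N = {p \<in> ?P. \<exists>c. \<forall>b\<in>?B. L b p = (\<Sum>t\<in>T. c t * L b t)}"
  have "ideal N (mpoly_ring X)"
  proof (rule ideal_mpoly_ringI)
    show "N \<subseteq> carrier (mpoly_ring X)" using P_closed(1) by (auto simp: N_def)
    show "0 \<in> N"
      using P_closed(2) by (auto simp: N_def L_def intro!: exI[of _ "\<lambda>_. 0"])
    show "p + q \<in> N" if pq: "p \<in> N" "q \<in> N" for p q
    proof -
      obtain c where c: "\<forall>b\<in>?B. L b p = (\<Sum>t\<in>T. c t * L b t)" using pq(1) by (auto simp: N_def)
      obtain d where d: "\<forall>b\<in>?B. L b q = (\<Sum>t\<in>T. d t * L b t)" using pq(2) by (auto simp: N_def)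
      have "\<forall>b\<in>?B. L b (p + q) = (\<Sum>t\<in>T. (c t + d t) * L b t)"
        using c d by (simp add: L_def coeff_sum_add distrib_right sum.distrib)
      then have "\<exists>c. \<forall>b\<in>?B. L b (p + q) = (\<Sum>t\<in>T. c t * L b t)"
        by (rule exI[of _ "\<lambda>t. c t + d t"])
      moreover have "p + q \<in> ?P" using pq P_closed(3) by (simp add: N_def)
      ultimately show ?thesis by (simp add: N_def)
    qed
    show "p * q \<in> N" if pq: "p \<in> carrier (mpoly_ring X)" "q \<in> N" for p q
    proof -
      obtain c where c: "\<forall>b\<in>?B. L b q = (\<Sum>t\<in>T. c t * L b t)" using pq(2) by (auto simp: N_def)
      have qP: "q \<in> ?P" using pq(2) by (simp add: N_def)
      have "\<forall>b\<in>?B. L b (p * q) = (\<Sum>t\<in>T. (lookup p 0 * c t) * L b t)"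
        using c component_functional_mult[OF qP pq(1)]
        by (auto simp: L_def nonroot_reps_def sum_distrib_left mult.assoc)
      then have "\<exists>c. \<forall>b\<in>?B. L b (p * q) = (\<Sum>t\<in>T. c t * L b t)"
        by (rule exI[of _ "\<lambda>t. lookup p 0 * c t"])
      moreover have "p * q \<in> ?P" using pq(1) qP by (rule P_closed(4))
      ultimately show ?thesis by (simp add: N_def)
    qed
  qed
  moreover have "T \<subseteq> N"
  proof
    fix t assume t: "t \<in> T"
    have "t \<in> ?P" using genideal_self[OF T] t gen by blast
    moreover have "\<forall>b\<in>?B. L b t = (\<Sum>t'\<in>T. of_bool (t' = t) * L b t')"
      using fin t by (simp add: sum.delta of_bool_def if_distrib[of "\<lambda>c. c * _"] cong: if_cong)
    then have "\<exists>c. \<forall>b\<in>?B. L b t = (\<Sum>t'\<in>T. c t' * L b t')"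
      by (rule exI[of _ "\<lambda>t'. of_bool (t' = t)"])
    ultimately show "t \<in> N" by (simp add: N_def)
  qed
  ultimately have "?P \<subseteq> N" using genideal_minimal[of N T] gen by blast
  have dual: "L b (monom b' 1 - monom (fiber_root X \<Phi> b') 1) = (if b' = b then 1 else 0)"
    if b: "b \<in> ?B" and b': "b' \<in> ?B" for b b'
  proof -
    have keys: "keys b \<subseteq> X" "keys b' \<subseteq> X"
      and rep: "component_rep X \<Phi> b = b" "component_rep X \<Phi> b' = b'"
      and root: "fiber_root X \<Phi> b \<noteq> b"
      using b b' by (auto simp: nonroot_reps_def)
    have "linked X \<Phi> b b' \<longleftrightarrow> b' = b"
      using component_rep_cong[of X \<Phi> b b'] rep by auto
    moreover have "\<not> linked X \<Phi> b (fiber_root X \<Phi> b')"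
    proof
      assume l: "linked X \<Phi> b (fiber_root X \<Phi> b')"
      then have "fiber_root X \<Phi> b' = b"
        using component_rep_cong[OF l] rep(1) fiber_root(3)[OF keys(2)] by simp
      moreover have "same_weights \<Phi> b b'"
        using same_weights_trans[OF linked_same_weights[OF l]
            same_weights_sym[OF fiber_root(2)[OF keys(2)]]] .
      then have "fiber_root X \<Phi> b = fiber_root X \<Phi> b'" by (rule fiber_root_cong)
      ultimately show False using root by simp
    qed
    ultimately show ?thesis by (simp add: L_def coeff_sum_diff)
  qed
  have le: "card J \<le> card T" if J: "finite J" "J \<subseteq> ?B" for J
  proof (rule ccontr)
    assume "\<not> card J \<le> card T"
    then have "card T < card J" by simp
    then obtain y where y: "\<exists>b\<in>J. y b \<noteq> 0" "\<forall>t\<in>T. (\<Sum>b\<in>J. y b * L b t) = 0"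
      using nontrivial_solution[OF fin J(1), of "\<lambda>t b. L b t"] by blast
    from y(1) obtain b' where b': "b' \<in> J" "y b' \<noteq> 0" by blast
    let ?p = "monom b' 1 - monom (fiber_root X \<Phi> b') 1"
    have "?p \<in> ?P"
      using b'(1) J(2) by (intro binomial_mem_matrix_ideal fiber_root) (auto simp: nonroot_reps_def)
    then obtain c where c: "\<forall>b\<in>?B. L b ?p = (\<Sum>t\<in>T. c t * L b t)"
      using \<open>?P \<subseteq> N\<close> by (auto simp: N_def)
    have "y b' = (\<Sum>b\<in>J. if b = b' then y b else 0)"
      using J(1) b'(1) by (simp add: sum.delta)
    also have "\<dots> = (\<Sum>b\<in>J. y b * L b ?p)"
      using J(2) b'(1) by (intro sum.cong) (auto simp: dual subset_iff)
    also have "\<dots> = (\<Sum>b\<in>J. \<Sum>t\<in>T. c t * (y b * L b t))"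
      using J(2) c by (intro sum.cong) (auto simp: sum_distrib_left mult.left_commute subset_iff)
    also have "\<dots> = (\<Sum>t\<in>T. c t * (\<Sum>b\<in>J. y b * L b t))"
      by (subst sum.swap) (simp add: sum_distrib_left)
    also have "\<dots> = 0" using y(2) by simp
    finally show False using b'(2) by simp
  qed
  show fB: "finite ?B"
  proof (rule ccontr)
    assume "infinite ?B"
    then obtain J where "J \<subseteq> ?B" "finite J" "card J = Suc (card T)"
      using infinite_arbitrarily_large by blast
    then show False using le[of J] by simp
  qed
  show "card ?B \<le> card T" using le[OF fB] by simp
qed

theorem min_num_generators_matrix_ideal:
  assumes hom: "homogeneous X \<Phi>" and \<Phi>: "finite \<Phi>"
  shows "min_num_generators (mpoly_ring X) (matrix_ideal X \<Phi> :: ('x, 'k::field) mpoly set) =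
    (if finite (nonroot_reps X \<Phi>) then enat (card (nonroot_reps X \<Phi>)) else \<infinity>)"
    (is "?\<mu> = _")
proof -
  let ?B = "nonroot_reps X \<Phi>"
  let ?P = "matrix_ideal X \<Phi> :: ('x, 'k) mpoly set"
  have lower: "(if finite ?B then enat (card ?B) else \<infinity>) \<le> ?\<mu>"
    unfolding min_num_generators_def
    using card_nonroot_reps_le_generators[OF \<Phi>] by (intro INF_greatest) auto
  moreover have "?\<mu> \<le> enat (card ?B)" if fin: "finite ?B"
  proof -
    let ?T = "(\<lambda>b. monom b (1::'k) - monom (fiber_root X \<Phi> b) 1) ` ?B"
    have "?T \<subseteq> carrier (mpoly_ring X)"
      by (auto simp: nonroot_reps_def intro!: diff_mem_mpoly_ring monom_mem_mpoly_ring fiber_root)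
    then have "?\<mu> \<le> enat (card ?T)"
      unfolding min_num_generators_def
      using fin matrix_ideal_eq_Idl[OF hom \<Phi>, where 'k = 'k] by (intro INF_lower) auto
    also have "\<dots> \<le> enat (card ?B)" using card_image_le[OF fin] by simp
    finally show ?thesis .
  qed
  ultimately show ?thesis by (auto intro: order.antisym)
qed

section \<open>Independence of the generating binomials\<close>

definition root_diff :: "'x set \<Rightarrow> ('x \<Rightarrow> nat) set \<Rightarrow> ('x \<Rightarrow>\<^sub>0 nat) \<Rightarrow> 'x \<Rightarrow> int" where
  "root_diff X \<Phi> b = exponent_diff b (fiber_root X \<Phi> b)"

lemma kernel_vector_in_span:
  assumes hom: "homogeneous X \<Phi>" and X: "finite X" and fin: "finite (nonroot_reps X \<Phi>)"
    and u: "kernel_vector X \<Phi> u" "\<And>x. x \<notin> X \<Longrightarrow> u x = 0"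
  shows "\<exists>z. \<forall>x. u x = (\<Sum>b\<in>nonroot_reps X \<Phi>. z b * root_diff X \<Phi> b x)"
proof -
  obtain m m' where m: "keys m \<subseteq> X" "keys m' \<subseteq> X" "exponent_diff m m' = u"
    using exponent_diff_surj[OF X u(2)] .
  have "same_weights \<Phi> m m'" using u(1) kernel_vector_exponent_diff[OF X m(1,2)] m(3) by simp
  with hom m(1,2) have "\<exists>z. \<forall>x. exponent_diff m m' x =
      (\<Sum>b\<in>nonroot_reps X \<Phi>. z b * root_diff X \<Phi> b x)"
  proof (induction rule: same_weights_induct)
    case (refl u)
    then show ?case by (intro exI[of _ "\<lambda>_. 0"]) (simp add: exponent_diff_def)
  next
    case (sym u v)
    then obtain z where z: "\<forall>x. exponent_diff u v x =
      (\<Sum>b\<in>nonroot_reps X \<Phi>. z b * root_diff X \<Phi> b x)" by blast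
    have "exponent_diff v u x = - exponent_diff u v x" for x by (simp add: exponent_diff_def)
    then show ?case using z by (intro exI[of _ "\<lambda>b. - z b"]) (simp add: sum_negf)
  next
    case (trans u v w)
    obtain z where z: "\<forall>x. exponent_diff u v x =
      (\<Sum>b\<in>nonroot_reps X \<Phi>. z b * root_diff X \<Phi> b x)" using trans(1) by blast
    obtain z' where z': "\<forall>x. exponent_diff v w x =
      (\<Sum>b\<in>nonroot_reps X \<Phi>. z' b * root_diff X \<Phi> b x)" using trans(2) by blast
    have "exponent_diff u w x = exponent_diff u v x + exponent_diff v w x" for x
      by (simp add: exponent_diff_def)
    then show ?case
      using z z' by (intro exI[of _ "\<lambda>b. z b + z' b"]) (simp add: distrib_right sum.distrib)
  next
    case (shift x u v)
    have "exponent_diff (monom x 1 + u) (monom x 1 + v) = exponent_diff u v"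
      by (rule ext) (simp add: exponent_diff_def lookup_add)
    then show ?case using shift by simp
  next
    case (root b)
    have "exponent_diff b (fiber_root X \<Phi> b) x =
        (\<Sum>b'\<in>nonroot_reps X \<Phi>. of_bool (b' = b) * root_diff X \<Phi> b' x)" for x
      using fin root
      by (simp add: root_diff_def sum.delta of_bool_def if_distrib[of "\<lambda>c. c * _"] cong: if_cong)
    then show ?case by (intro exI[of _ "\<lambda>b'. of_bool (b' = b)"] allI)
  qed
  then show ?thesis by (simp add: m(3))
qed

text \<open>The relations that express the columns outside a basis by the basis form a diagonal matrix in
  the coordinates outside the basis, so they are independent, and \<open>card (X - S)\<close> is the rank of
  the kernel. The factor \<open>c\<close> stands for rational coefficients.\<close>

lemma card_le_spanning_set:
  fixes D :: "'j \<Rightarrow> 'x \<Rightarrow> int"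
  assumes X: "finite X" and S: "column_basis X \<Phi> S" and J: "finite J"
    and span: "\<And>u. kernel_vector X \<Phi> u \<Longrightarrow> (\<And>x. x \<notin> X \<Longrightarrow> u x = 0) \<Longrightarrow>
      \<exists>c z. c \<noteq> 0 \<and> (\<forall>x. c * u x = (\<Sum>j\<in>J. z j * D j x))"
  shows "card (X - S) \<le> card J"
proof (rule ccontr)
  assume "\<not> card (X - S) \<le> card J"
  then have less: "card J < card (X - S)" by simp
  have "\<exists>w z. (\<forall>x. w x = (\<Sum>j\<in>J. z j * D j x)) \<and> w e \<noteq> 0 \<and> (\<forall>x\<in>X - S. x \<noteq> e \<longrightarrow> w x = 0)"
    if e: "e \<in> X - S" for e
  proof -
    obtain u where u: "\<forall>x. x \<notin> insert e S \<longrightarrow> u x = 0" "kernel_vector X \<Phi> u" "u e \<noteq> 0"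
      using column_basisD(3)[OF S e] by blast
    have "u x = 0" if "x \<notin> X" for x
    proof -
      have "x \<notin> insert e S" using e column_basisD(1)[OF S] that by blast
      then show ?thesis using u(1) by simp
    qed
    then obtain c z where cz: "c \<noteq> 0" "\<forall>x. c * u x = (\<Sum>j\<in>J. z j * D j x)"
      using span[OF u(2)] by blast
    have "\<forall>x\<in>X - S. x \<noteq> e \<longrightarrow> c * u x = 0" using u(1) by simp
    moreover have "c * u e \<noteq> 0" using cz(1) u(3) by simp
    ultimately show ?thesis using cz(2) by (intro exI[of _ "\<lambda>x. c * u x"] exI[of _ z]) blast
  qed
  then have "\<forall>e\<in>X - S. \<exists>wz. (\<forall>x. fst wz x = (\<Sum>j\<in>J. snd wz j * D j x)) \<and> fst wz e \<noteq> 0 \<and>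
      (\<forall>x\<in>X - S. x \<noteq> e \<longrightarrow> fst wz x = 0)" by simp
  then have "\<exists>wz. \<forall>e\<in>X - S. (\<forall>x. fst (wz e) x = (\<Sum>j\<in>J. snd (wz e) j * D j x)) \<and>
      fst (wz e) e \<noteq> 0 \<and> (\<forall>x\<in>X - S. x \<noteq> e \<longrightarrow> fst (wz e) x = 0)" by (rule bchoice)
  then obtain wz where wz: "\<And>e x. e \<in> X - S \<Longrightarrow> fst (wz e) x = (\<Sum>j\<in>J. snd (wz e) j * D j x)"
    "\<And>e. e \<in> X - S \<Longrightarrow> fst (wz e) e \<noteq> 0"
    "\<And>e x. e \<in> X - S \<Longrightarrow> x \<in> X - S \<Longrightarrow> x \<noteq> e \<Longrightarrow> fst (wz e) x = 0"
    by blast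
  obtain y where y: "\<exists>e\<in>X - S. y e \<noteq> 0" "\<forall>j\<in>J. (\<Sum>e\<in>X - S. y e * snd (wz e) j) = 0"
    using nontrivial_solution[OF J _ less, of "\<lambda>j e. snd (wz e) j"] X by auto
  from y(1) obtain e where e: "e \<in> X - S" "y e \<noteq> 0" by blast
  have "y e * fst (wz e) e = (\<Sum>e'\<in>X - S. if e' = e then y e' * fst (wz e') e else 0)"
    using X e(1) by (simp add: sum.delta)
  also have "\<dots> = (\<Sum>e'\<in>X - S. y e' * fst (wz e') e)"
    using wz(3) e(1) by (intro sum.cong) auto
  also have "\<dots> = (\<Sum>e'\<in>X - S. \<Sum>j\<in>J. (y e' * snd (wz e') j) * D j e)"
    using wz(1) by (intro sum.cong) (simp_all add: sum_distrib_left mult.assoc)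
  also have "\<dots> = (\<Sum>j\<in>J. (\<Sum>e'\<in>X - S. y e' * snd (wz e') j) * D j e)"
    by (subst sum.swap) (simp add: sum_distrib_right)
  also have "\<dots> = 0" using y(2) by simp
  finally show False using e(2) wz(2)[OF e(1)] by simp
qed

lemma card_le_nonroot_reps:
  assumes "homogeneous X \<Phi>" "finite X" "finite (nonroot_reps X \<Phi>)" "column_basis X \<Phi> S"
  shows "card (X - S) \<le> card (nonroot_reps X \<Phi>)"
proof (rule card_le_spanning_set[OF assms(2,4,3), where D = "root_diff X \<Phi>"])
  fix u :: "'a \<Rightarrow> int" assume "kernel_vector X \<Phi> u" "\<And>x. x \<notin> X \<Longrightarrow> u x = 0"
  then obtain z where "\<forall>x. u x = (\<Sum>b\<in>nonroot_reps X \<Phi>. z b * root_diff X \<Phi> b x)"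
    using kernel_vector_in_span[OF assms(1-3)] by blast
  then show "\<exists>c z. c \<noteq> 0 \<and> (\<forall>x. c * u x = (\<Sum>b\<in>nonroot_reps X \<Phi>. z b * root_diff X \<Phi> b x))"
    by (intro exI[of _ 1] exI[of _ z]) simp
qed

text \<open>A spanning set of minimal cardinality is independent: from a relation with \<open>y b0 \<noteq> 0\<close>, the
  vector at \<open>b0\<close> could be eliminated.\<close>

lemma root_diff_independent:
  assumes hom: "homogeneous X \<Phi>" and X: "finite X" and fin: "finite (nonroot_reps X \<Phi>)"
    and S: "column_basis X \<Phi> S" and le: "card (nonroot_reps X \<Phi>) \<le> card (X - S)"
    and y: "\<And>x. (\<Sum>b\<in>nonroot_reps X \<Phi>. y b * root_diff X \<Phi> b x) = 0"
    and b0: "b0 \<in> nonroot_reps X \<Phi>"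
  shows "y b0 = 0"
proof (rule ccontr)
  assume y0: "y b0 \<noteq> 0"
  let ?B = "nonroot_reps X \<Phi>"
  have "card (X - S) \<le> card (?B - {b0})"
  proof (rule card_le_spanning_set[OF X S, where D = "root_diff X \<Phi>"])
    fix u :: "'a \<Rightarrow> int" assume u: "kernel_vector X \<Phi> u" "\<And>x. x \<notin> X \<Longrightarrow> u x = 0"
    obtain z where z: "\<forall>x. u x = (\<Sum>b\<in>?B. z b * root_diff X \<Phi> b x)"
      using kernel_vector_in_span[OF hom X fin u] by blast
    have "y b0 * u x = (\<Sum>b\<in>?B - {b0}. (y b0 * z b - z b0 * y b) * root_diff X \<Phi> b x)" for x
    proof -
      have "y b0 * u x = y b0 * u x - z b0 * (\<Sum>b\<in>?B. y b * root_diff X \<Phi> b x)"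
        using y by simp
      also have "\<dots> = (\<Sum>b\<in>?B. (y b0 * z b - z b0 * y b) * root_diff X \<Phi> b x)"
        using z by (simp add: sum_distrib_left sum_subtractf algebra_simps)
      also have "\<dots> = (\<Sum>b\<in>?B - {b0}. (y b0 * z b - z b0 * y b) * root_diff X \<Phi> b x)"
        using fin b0 by (simp add: sum.remove[of _ b0] mult.commute)
      finally show ?thesis .
    qed
    then show "\<exists>c z. c \<noteq> 0 \<and> (\<forall>x. c * u x = (\<Sum>b\<in>?B - {b0}. z b * root_diff X \<Phi> b x))"
      using y0 by (intro exI[of _ "y b0"] exI[of _ "\<lambda>b. y b0 * z b - z b0 * y b"]) simp
  qed (use fin in simp)
  moreover have "card (?B - {b0}) < card ?B" using fin b0 by (rule card_Diff1_less)
  ultimately show False using le by simp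
qed

section \<open>Faces\<close>

text \<open>The columns in \<open>X'\<close> are the columns of \<open>X\<close> that lie on a face of the cone that they generate:
  a sum of columns that equals a sum of columns of the face has all its summands in the face.\<close>

definition face :: "('x \<Rightarrow> nat) set \<Rightarrow> 'x set \<Rightarrow> 'x set \<Rightarrow> bool" where
  "face \<Phi> X' X \<longleftrightarrow> X' \<subseteq> X \<and> (\<forall>m m'. keys m \<subseteq> X' \<longrightarrow> keys m' \<subseteq> X \<longrightarrow> same_weights \<Phi> m m' \<longrightarrow>
     keys m' \<subseteq> X')"

lemma overlap_face:
  assumes "face \<Phi> X' X" "keys m \<subseteq> X'"
  shows "overlap X' \<Phi> m m' \<longleftrightarrow> overlap X \<Phi> m m'"
  using assms unfolding face_def overlap_def by blast

lemma linked_face: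
  assumes face: "face \<Phi> X' X" and m: "keys m \<subseteq> X'"
  shows "linked X' \<Phi> m = linked X \<Phi> m"
proof (intro ext iffI)
  fix m'
  show "linked X \<Phi> m m'" if "linked X' \<Phi> m m'"
    using that
  proof (rule rtranclp_mono[THEN predicate2D, rotated])
    show "overlap X' \<Phi> \<le> overlap X \<Phi>"
      using overlap_face[OF face] by (intro predicate2I) (metis overlap_def)
  qed
  show "linked X' \<Phi> m m'" if "linked X \<Phi> m m'"
    using that
  proof (induction rule: rtranclp_induct)
    case (step y z)
    have "keys y \<subseteq> X'" using linked_keys[OF step.IH m] .
    then show ?case
      using step.IH step.hyps(2) overlap_face[OF face] by (meson rtranclp.rtrancl_into_rtrancl)
  qed simp
qed

text \<open>A fiber with a monomial in \<open>X'\<close> is the same for \<open>X'\<close> and for \<open>X\<close>, and so are its components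
  and the choices made in it.\<close>

lemma nonroot_reps_face:
  assumes face: "face \<Phi> X' X"
  shows "nonroot_reps X' \<Phi> = {b \<in> nonroot_reps X \<Phi>. keys b \<subseteq> X'}"
    and "b \<in> nonroot_reps X' \<Phi> \<Longrightarrow> root_diff X' \<Phi> b = root_diff X \<Phi> b"
proof -
  have rep: "component_rep X' \<Phi> m = component_rep X \<Phi> m" if "keys m \<subseteq> X'" for m
    unfolding component_rep_def linked_face[OF face that] ..
  have root: "fiber_root X' \<Phi> m = fiber_root X \<Phi> m" if m: "keys m \<subseteq> X'" for m
  proof -
    have eq: "(\<lambda>m'. keys m' \<subseteq> X' \<and> same_weights \<Phi> m m') =
        (\<lambda>m'. keys m' \<subseteq> X \<and> same_weights \<Phi> m m')"
      using face m unfolding face_def by (intro ext) blast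
    have "keys (SOME m'. keys m' \<subseteq> X' \<and> same_weights \<Phi> m m') \<subseteq> X'"
      using someI[of "\<lambda>m'. keys m' \<subseteq> X' \<and> same_weights \<Phi> m m'" m] m by simp
    then show ?thesis
      using rep unfolding fiber_root_def eq by simp
  qed
  show "nonroot_reps X' \<Phi> = {b \<in> nonroot_reps X \<Phi>. keys b \<subseteq> X'}"
    using face rep root unfolding nonroot_reps_def face_def by auto
  show "root_diff X' \<Phi> b = root_diff X \<Phi> b" if "b \<in> nonroot_reps X' \<Phi>"
    using that root by (simp add: root_diff_def nonroot_reps_def)
qed

text \<open>For \<open>X\<close>, equality says that the exponent differences of the generating binomials are linearly
  independent. Those for \<open>X'\<close> are among them, and being independent there are at most as many as
  the rank of the kernel lattice of \<open>X'\<close>. There are at least as many because they span it.\<close>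

theorem matrix_ideal_face_complete_intersection:
  assumes X: "finite X" and \<Phi>: "finite \<Phi>" and hom: "homogeneous X \<Phi>" and face: "face \<Phi> X' X"
    and ci: "min_num_generators (mpoly_ring X) (matrix_ideal X \<Phi> :: ('x, 'k::field) mpoly set) =
      ideal_height (mpoly_ring X) (matrix_ideal X \<Phi> :: ('x, 'k) mpoly set)"
  shows "min_num_generators (mpoly_ring X') (matrix_ideal X' \<Phi> :: ('x, 'k) mpoly set) =
    ideal_height (mpoly_ring X') (matrix_ideal X' \<Phi> :: ('x, 'k) mpoly set)"
proof -
  have X': "finite X'" and sub: "X' \<subseteq> X" using face X finite_subset by (auto simp: face_def)
  have hom': "homogeneous X' \<Phi>" using hom sub unfolding homogeneous_def by (meson order_trans)
  obtain S where S: "column_basis X \<Phi> S" using ex_column_basis[OF X] .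
  obtain S' where S': "column_basis X' \<Phi> S'" using ex_column_basis[OF X'] .
  let ?B = "nonroot_reps X \<Phi>" and ?B' = "nonroot_reps X' \<Phi>"
  have "(if finite ?B then enat (card ?B) else \<infinity>) = enat (card (X - S))"
    using ci
    unfolding min_num_generators_matrix_ideal[OF hom \<Phi>] ideal_height_matrix_ideal[OF X \<Phi> S] .
  then have fin: "finite ?B" and card: "card ?B = card (X - S)" by (auto split: if_splits)
  have B': "?B' \<subseteq> ?B" using nonroot_reps_face(1)[OF face] by blast
  have fin': "finite ?B'" using finite_subset[OF B' fin] .
  have "card ?B' \<le> card (X' - S')"
  proof (rule ccontr)
    assume "\<not> card ?B' \<le> card (X' - S')"
    then obtain y where y: "\<exists>b\<in>?B'. y b \<noteq> 0"
      "\<forall>x\<in>X' - S'. (\<Sum>b\<in>?B'. y b * root_diff X' \<Phi> b x) = 0"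
      using nontrivial_solution[of "X' - S'" ?B' "\<lambda>x b. root_diff X' \<Phi> b x"] X' fin' by auto
    define u where "u x = (\<Sum>b\<in>?B'. y b * root_diff X' \<Phi> b x)" for x
    have "kernel_vector X' \<Phi> u"
      unfolding u_def
    proof (rule kernel_vector_sum)
      fix b assume "b \<in> ?B'"
      then have b: "keys b \<subseteq> X'" by (simp add: nonroot_reps_def)
      show "kernel_vector X' \<Phi> (root_diff X' \<Phi> b)"
        unfolding root_diff_def
        using kernel_vector_exponent_diff[OF X' b fiber_root(1)[OF b]] fiber_root(2)[OF b] by blast
    qed
    moreover have "u x = 0" if "x \<notin> S'" for x
    proof (cases "x \<in> X'")
      case True
      then show ?thesis using y(2) that by (simp add: u_def)
    next
      case False
      have "root_diff X' \<Phi> b x = 0" if "b \<in> ?B'" for b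
      proof -
        have b: "keys b \<subseteq> X'" using that by (simp add: nonroot_reps_def)
        show ?thesis
          using lookup_outside_keys[OF b False] lookup_outside_keys[OF fiber_root(1)[OF b] False]
          by (simp add: root_diff_def exponent_diff_def)
      qed
      then show ?thesis by (simp add: u_def)
    qed
    ultimately have u0: "u x = 0" for x using column_basisD(2)[OF S'] by blast
    define y' where "y' b = (if b \<in> ?B' then y b else 0)" for b
    have "(\<Sum>b\<in>?B. y' b * root_diff X \<Phi> b x) = 0" for x
    proof -
      have "(\<Sum>b\<in>?B. y' b * root_diff X \<Phi> b x) = (\<Sum>b\<in>?B'. y' b * root_diff X \<Phi> b x)"
        using B' fin by (intro sum.mono_neutral_right) (auto simp: y'_def)
      also have "\<dots> = u x"
        unfolding u_def using nonroot_reps_face(2)[OF face] by (intro sum.cong) (auto simp: y'_def)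
      finally show ?thesis using u0 by simp
    qed
    then have "y' b = 0" if "b \<in> ?B" for b
      using root_diff_independent[OF hom X fin S] card that by simp
    moreover obtain b where "b \<in> ?B'" "y b \<noteq> 0" using y(1) by blast
    ultimately show False using B' by (fastforce simp: y'_def)
  qed
  with card_le_nonroot_reps[OF hom' X' fin' S'] have "card ?B' = card (X' - S')" by simp
  then show ?thesis
    unfolding min_num_generators_matrix_ideal[OF hom' \<Phi>] ideal_height_matrix_ideal[OF X' \<Phi> S']
    using fin' by simp
qed

section \<open>Graphs\<close>

abbreviation incidence_rows :: "'v set \<Rightarrow> ('v set \<Rightarrow> nat) set" where
  "incidence_rows V \<equiv> (\<lambda>v e. of_bool (v \<in> e)) ` V"

lemma toric_ideal_eq_matrix_ideal:
  assumes H: "simple_graph H" and V: "verts H \<subseteq> V"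
  shows "toric_ideal H =
    (matrix_ideal (edges H) (incidence_rows V) :: ('v set, 'k::field) mpoly set)"
proof -
  define a :: "'v set \<Rightarrow> 'v \<Rightarrow>\<^sub>0 nat" where "a e = (\<Sum>v\<in>e. monom v 1)" for e
  have "(\<lambda>e. \<Prod>v\<in>e. mpoly_var v) = (\<lambda>e. monom (a e) (1::'k))"
    by (rule ext) (simp add: mpoly_var_def prod_monom a_def)
  then have map: "toric_map = mpoly_subst (\<lambda>e. monom (a e) (1::'k))"
    by (simp add: toric_map_def)
  have edge: "finite e" "e \<subseteq> V" if "e \<in> edges H" for e
    using H V that finite_subset unfolding simple_graph_def by blast+
  have lookup_a: "lookup (a e) v = of_bool (v \<in> e)" if "e \<in> edges H" for e v
    using edge(1)[OF that]
    by (simp add: a_def lookup_sum lookup_single when_def sum.delta of_bool_def)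
  have weight: "lookup (image_exponent a m) v = weight (\<lambda>e. of_bool (v \<in> e)) m"
    if "keys m \<subseteq> edges H" for m v
    unfolding lookup_image_exponent weight_def
    using that lookup_a by (intro sum.cong) auto
  have outside: "weight (\<lambda>e. of_bool (v \<in> e)) m = 0" if "keys m \<subseteq> edges H" "v \<notin> V" for m v
    unfolding weight_def using that edge(2) by (intro sum.neutral) auto
  have "image_exponent a m = image_exponent a m' \<longleftrightarrow> same_weights (incidence_rows V) m m'"
    if "keys m \<subseteq> edges H" "keys m' \<subseteq> edges H" for m m'
  proof -
    have "image_exponent a m = image_exponent a m' \<longleftrightarrow>
        (\<forall>v. weight (\<lambda>e. of_bool (v \<in> e)) m = weight (\<lambda>e. of_bool (v \<in> e)) m')"
      by (simp add: poly_mapping_eq_iff fun_eq_iff weight that)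
    also have "\<dots> \<longleftrightarrow> (\<forall>v\<in>V. weight (\<lambda>e. of_bool (v \<in> e)) m = weight (\<lambda>e. of_bool (v \<in> e)) m')"
      using outside that by metis
    finally show ?thesis by (simp add: same_weights_def)
  qed
  then have "{p \<in> carrier (mpoly_ring (edges H)). mpoly_subst (\<lambda>e. monom (a e) (1::'k)) p = 0} =
      matrix_ideal (edges H) (incidence_rows V)"
    by (rule kernel_monomial_map)
  then show ?thesis
    by (simp add: toric_ideal_def a_kernel_def' map)
qed

text \<open>Each edge has two ends, so the weights at the vertices add up to twice the total degree.\<close>

lemma homogeneous_incidence_rows:
  assumes V: "finite V" and X: "\<And>e. e \<in> X \<Longrightarrow> e \<subseteq> V \<and> card e = 2"
  shows "homogeneous X (incidence_rows V)"
proof -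
  have "(\<Sum>v\<in>V. weight (\<lambda>e. of_bool (v \<in> e)) m) = 2 * weight (\<lambda>_. 1) m" if "keys m \<subseteq> X" for m
  proof -
    have "(\<Sum>v\<in>V. weight (\<lambda>e. of_bool (v \<in> e)) m) =
        (\<Sum>e\<in>keys m. (\<Sum>v\<in>V. of_bool (v \<in> e)) * lookup m e)"
      unfolding weight_def by (subst sum.swap) (simp add: sum_distrib_right)
    also have "\<dots> = (\<Sum>e\<in>keys m. 2 * lookup m e)"
    proof (rule sum.cong[OF refl])
      fix e assume "e \<in> keys m"
      then have e: "e \<subseteq> V" "card e = 2" using X that by auto
      have "(\<Sum>v\<in>V. of_bool (v \<in> e)) = card (V \<inter> e)"
        using V by (simp add: of_bool_def sum.If_cases)
      also have "V \<inter> e = e" using e(1) by blast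
      finally show "(\<Sum>v\<in>V. of_bool (v \<in> e)) * lookup m e = 2 * lookup m e"
        using e(2) by simp
    qed
    finally show ?thesis by (simp add: weight_def sum_distrib_left)
  qed
  moreover have "(\<Sum>v\<in>V. weight (\<lambda>e. of_bool (v \<in> e)) m) = (\<Sum>v\<in>V. weight (\<lambda>e. of_bool (v \<in> e)) m')"
    if "same_weights (incidence_rows V) m m'" for m m'
    using that by (intro sum.cong) (auto simp: same_weights_def)
  ultimately show ?thesis
    unfolding homogeneous_def by (metis mult_cancel1 zero_neq_numeral)
qed

text \<open>The weights at the vertices outside \<open>G'\<close> vanish on the monomials in the edges of \<open>G'\<close>. If they
  vanish on a monomial in the edges of \<open>G\<close>, then all ends of its edges lie in \<open>G'\<close>, and so do the
  edges because the subgraph is induced.\<close>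

lemma face_induced_subgraph:
  assumes G: "simple_graph G" and G': "induced_subgraph G' G"
  shows "face (incidence_rows (verts G)) (edges G') (edges G)"
  unfolding face_def
proof (intro conjI allI impI)
  show "edges G' \<subseteq> edges G" using G' by (auto simp: induced_subgraph_def)
  fix m m' :: "'a set \<Rightarrow>\<^sub>0 nat"
  assume m: "keys m \<subseteq> edges G'" and m': "keys m' \<subseteq> edges G"
    and same: "same_weights (incidence_rows (verts G)) m m'"
  show "keys m' \<subseteq> edges G'"
  proof
    fix e assume e: "e \<in> keys m'"
    have "v \<in> verts G'" if v: "v \<in> e" for v
    proof (rule ccontr)
      assume nv: "v \<notin> verts G'"
      have "v \<in> verts G" using G m' e v by (auto simp: simple_graph_def)
      then have "weight (\<lambda>e. of_bool (v \<in> e)) m' = weight (\<lambda>e. of_bool (v \<in> e)) m"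
        using same by (simp add: same_weights_def)
      also have "\<dots> = 0"
        unfolding weight_def using m G' nv
        by (intro sum.neutral) (auto simp: induced_subgraph_def)
      finally have "of_bool (v \<in> e) * lookup m' e = 0"
        using e by (simp add: weight_def)
      then show False using v e by (simp add: in_keys_iff)
    qed
    then show "e \<in> edges G'" using G' m' e by (auto simp: induced_subgraph_def)
  qed
qed

theorem theorem3p4:
  fixes G G' :: "'v graph"
  assumes "simple_graph G"
    and "induced_subgraph G' G"
    and "complete_intersection TYPE('k::field) G"
  shows "complete_intersection TYPE('k) G'"
proof -
  let ?\<Phi> = "incidence_rows (verts G)"
  have G: "finite (verts G)" "\<And>e. e \<in> edges G \<Longrightarrow> e \<subseteq> verts G \<and> card e = 2"
    using assms(1) by (auto simp: simple_graph_def)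
  have sub: "verts G' \<subseteq> verts G" using assms(2) by (simp add: induced_subgraph_def)
  have G': "simple_graph G'"
    using assms(1,2) finite_subset[OF sub] by (auto simp: simple_graph_def induced_subgraph_def)
  have hom: "homogeneous (edges G) ?\<Phi>" using G(2) by (intro homogeneous_incidence_rows[OF G(1)])
  have X: "finite (edges G)"
    using G by (intro finite_subset[of "edges G" "Pow (verts G)"]) auto
  let ?P = "\<lambda>E. matrix_ideal E ?\<Phi> :: ('v set, 'k) mpoly set"
  have "min_num_generators (mpoly_ring (edges G)) (?P (edges G)) =
      ideal_height (mpoly_ring (edges G)) (?P (edges G))"
    using assms(3) unfolding complete_intersection_def Let_def
      toric_ideal_eq_matrix_ideal[OF assms(1) order_refl] .
  then have "min_num_generators (mpoly_ring (edges G')) (?P (edges G')) =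
      ideal_height (mpoly_ring (edges G')) (?P (edges G'))"
    by (rule matrix_ideal_face_complete_intersection[OF X finite_imageI[OF G(1)] hom
          face_induced_subgraph[OF assms(1,2)]])
  then show ?thesis
    unfolding complete_intersection_def Let_def toric_ideal_eq_matrix_ideal[OF G' sub] .
qed

end
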